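(* Let $n,p$ be real numbers with $0<p<n/2$ and let $W=W_{p,n}$. The algebra $\mathcal D(W)$ is generated by $\{D_1,D_2,D_3,D_4\}$, where $D_1,\dots,D_4$ are the operators listed in the context. Moreover, if $D=\sum_{\ell=0}^s\partial^\ell F_\ell\in\mathcal D(W)$ with $F_s\neq\mathbf 0$, then $s$ is even and the matrix polynomial $F_s$ is of degree $s$.
   Context: Weight: for real $0<p<n/2$, $$W_{p,n}(x)=(1-x^2)^{\frac n2-1}\begin{pmatrix} p\,x^2+n-p & -nx\\ -nx & (n-p)x^2+p\end{pmatrix},\quad x\in[-1,1].$$ $M_2$ denotes complex $2\times2$ matrices, $T^*$ the conjugate transpose. On $M_2[x]$ use the matrix-valued form $(P,Q)=\int_{-1}^1 P(x)W(x)Q(x)^*\,dx$; $\{Q_w\}_{w\ge0}$ is the unique sequence of monic orthogonal polynomials ($Q_w\in M_2[x]$ monic of degree $w$, $(Q_w,Q_{w'})=0$ for $w\neq w'$). Differential operators $D=\sum_{i=0}^s\partial^iF_i$, $\partial=\frac{d}{dx}$, $F_i\in M_2[x]$, act on the right: $PD=\sum_i \partial^i(P)\,F_i$; the product satisfies $P(DE)=(PD)E$. $$\mathcal D(W)=\{D:\ Q_wD=\Lambda_w(D)Q_w \text{ for some }\Lambda_w(D)\in M_2,\ \text{for all } w\ge0\},$$ an associative unital algebra over $\mathbb C$ with identity $\mathbf I$ (generated subalgebras are taken to be unital). (The coefficients of any such $D$ are automatically polynomials with $\deg F_i\le i$.) The degree of a matrix polynomial is the largest power of $x$ with nonzero matrix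 coefficient. The operators: $$D_1=\partial^2\begin{pmatrix} x^2 & x \\ -x & -1 \end{pmatrix}+\partial\begin{pmatrix} (n+2)x & n-p+2 \\ -p & 0 \end{pmatrix}+\begin{pmatrix} p(n-p+1) & 0 \\ 0 & 0 \end{pmatrix},$$ $$D_2=\partial^2\begin{pmatrix} -1 & -x \\ x & x^2 \end{pmatrix}+\partial\begin{pmatrix} 0 & p-n \\ p+2 & (n+2)x \end{pmatrix}+\begin{pmatrix} 0 & 0 \\ 0 & (p+1)(n-p) \end{pmatrix},$$ $$D_3=\partial^2\begin{pmatrix} -x & -1 \\ x^2 & x \end{pmatrix}+\partial\begin{pmatrix} -p & 0 \\ 2(p+1)x & p+2 \end{pmatrix}+\begin{pmatrix} 0 & 0 \\ p(p+1) & 0 \end{pmatrix},$$ $$D_4=\partial^2\begin{pmatrix} x & x^2 \\ -1 & -x \end{pmatrix}+\partial\begin{pmatrix} n-p+2 & 2(n-p+1)x \\ 0 & p-n \end{pmatrix}+\begin{pmatrix} 0 & (n-p)(n-p+1) \\ 0 & 0 \end{pmatrix}.$$ *)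

theory Defs
  imports "HOL-Analysis.Analysis" "HOL-Computational_Algebra.Polynomial"
begin

text \<open>Elements of $M_2[x]$ are matrices with polynomial entries, multiplied with \<open>**\<close>
  (the class multiplication on vectors is entrywise and is never used).\<close>

type_synonym cmat = "complex^2^2"
type_synonym mpol = "complex poly^2^2"

definition mat2 :: "'a::zero \<Rightarrow> 'a \<Rightarrow> 'a \<Rightarrow> 'a \<Rightarrow> 'a^2^2" where
  "mat2 a b c d = vector [vector [a, b], vector [c, d]]"

definition conj_transpose :: "cmat \<Rightarrow> cmat" where
  "conj_transpose A = map_matrix cnj (transpose A)"

definition mcoeff :: "mpol \<Rightarrow> nat \<Rightarrow> cmat" where
  "mcoeff P k = map_matrix (\<lambda>q. coeff q k) P"

text \<open>Only meaningful for a nonzero matrix polynomial.\<close>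

definition mdegree :: "mpol \<Rightarrow> nat" where
  "mdegree P = Max {k. mcoeff P k \<noteq> 0}"

definition mmonic :: "nat \<Rightarrow> mpol \<Rightarrow> bool" where
  "mmonic w P \<longleftrightarrow> mdegree P = w \<and> mcoeff P w = mat 1"

definition mconst :: "cmat \<Rightarrow> mpol" where
  "mconst A = map_matrix (\<lambda>a. [:a:]) A"

definition meval :: "mpol \<Rightarrow> real \<Rightarrow> cmat" where
  "meval P x = map_matrix (\<lambda>q. poly q (complex_of_real x)) P"

definition weight :: "real \<Rightarrow> real \<Rightarrow> real \<Rightarrow> cmat" where
  "weight n p x = (1 - x\<^sup>2) powr (n / 2 - 1) *\<^sub>R
     map_matrix complex_of_real
       (mat2 (p * x\<^sup>2 + n - p) (- n * x)
             (- n * x) ((n - p) * x\<^sup>2 + p))"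

definition mform :: "(real \<Rightarrow> cmat) \<Rightarrow> mpol \<Rightarrow> mpol \<Rightarrow> cmat" where
  "mform W P Q = integral {-1..1} (\<lambda>x. meval P x ** W x ** conj_transpose (meval Q x))"

definition monic_orthogonal :: "(real \<Rightarrow> cmat) \<Rightarrow> (nat \<Rightarrow> mpol) \<Rightarrow> bool" where
  "monic_orthogonal W Q \<longleftrightarrow>
     (\<forall>w. mmonic w (Q w)) \<and> (\<forall>w w'. w \<noteq> w' \<longrightarrow> mform W (Q w) (Q w') = 0)"

definition orthopol :: "(real \<Rightarrow> cmat) \<Rightarrow> nat \<Rightarrow> mpol" where
  "orthopol W = (THE Q. monic_orthogonal W Q)"

text \<open>The operator $\sum_{i \le s} \partial^i F_i$ is represented by the map $P \mapsto PD$ on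
  $M_2[x]$. This loses nothing: the map determines the coefficients (lemma
  \<open>diffop_coeffs_unique\<close> below).\<close>

type_synonym mop = "mpol \<Rightarrow> mpol"

definition diffop :: "nat \<Rightarrow> (nat \<Rightarrow> mpol) \<Rightarrow> mop" where
  "diffop s F P = (\<Sum>i\<le>s. (map_matrix pderiv ^^ i) P ** F i)"

definition diff_algebra :: "(real \<Rightarrow> cmat) \<Rightarrow> mop set" where
  "diff_algebra W = {D. (\<exists>s F. D = diffop s F) \<and>
     (\<forall>w. \<exists>\<Lambda>. D (orthopol W w) = mconst \<Lambda> ** orthopol W w)}"

text \<open>The unital complex subalgebra generated by a set of operators. Operators act on the
  right, so the product $DE$ applies $D$ first: $P(DE) = (PD)E$.\<close>

inductive_set gen_algebra :: "mop set \<Rightarrow> mop set" for S :: "mop set" where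
  gen: "D \<in> S \<Longrightarrow> D \<in> gen_algebra S"
| one: "(\<lambda>P. P) \<in> gen_algebra S"
| add: "D \<in> gen_algebra S \<Longrightarrow> E \<in> gen_algebra S \<Longrightarrow> (\<lambda>P. D P + E P) \<in> gen_algebra S"
| scale: "D \<in> gen_algebra S \<Longrightarrow> (\<lambda>P. map_matrix (smult c) (D P)) \<in> gen_algebra S"
| mult: "D \<in> gen_algebra S \<Longrightarrow> E \<in> gen_algebra S \<Longrightarrow> (\<lambda>P. E (D P)) \<in> gen_algebra S"

text \<open>\<open>diffop2 F2 F1 F0\<close> is $\partial^2 F_2 + \partial F_1 + F_0$. The matrices are written with
  real polynomial entries and then embedded into $M_2[x]$.\<close>

definition diffop2 :: "real poly^2^2 \<Rightarrow> real poly^2^2 \<Rightarrow> real poly^2^2 \<Rightarrow> mop" where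
  "diffop2 F2 F1 F0 =
     diffop 2 (\<lambda>i. map_matrix (map_poly complex_of_real) ([F0, F1, F2] ! i))"

definition D1 :: "real \<Rightarrow> real \<Rightarrow> mop" where
  "D1 n p = diffop2
     (mat2 [:0, 0, 1:]  [:0, 1:]
           [:0, -1:]    [:-1:])
     (mat2 [:0, n + 2:] [:n - p + 2:]
           [:- p:]      0)
     (mat2 [:p * (n - p + 1):] 0
           0                   0)"

definition D2 :: "real \<Rightarrow> real \<Rightarrow> mop" where
  "D2 n p = diffop2
     (mat2 [:-1:]   [:0, -1:]
           [:0, 1:] [:0, 0, 1:])
     (mat2 0         [:p - n:]
           [:p + 2:] [:0, n + 2:])
     (mat2 0 0
           0 [:(p + 1) * (n - p):])"

definition D3 :: "real \<Rightarrow> real \<Rightarrow> mop" where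
  "D3 n p = diffop2
     (mat2 [:0, -1:]   [:-1:]
           [:0, 0, 1:] [:0, 1:])
     (mat2 [:- p:]              0
           [:0, 2 * (p + 1):]   [:p + 2:])
     (mat2 0               0
           [:p * (p + 1):] 0)"

definition D4 :: "real \<Rightarrow> real \<Rightarrow> mop" where
  "D4 n p = diffop2
     (mat2 [:0, 1:] [:0, 0, 1:]
           [:-1:]   [:0, -1:])
     (mat2 [:n - p + 2:] [:0, 2 * (n - p + 1):]
           0             [:p - n:])
     (mat2 0 [:(n - p) * (n - p + 1):]
           0 0)"

lemma pderiv_iterate:
  "(map_matrix pderiv ^^ i) P = map_matrix (pderiv ^^ i) P" for P :: mpol
  by (induction i) (simp_all add: vec_eq_iff)

lemma pderiv_iterate_monom:
  "i \<le> k \<Longrightarrow> (pderiv ^^ i) (monom 1 k :: complex poly) = monom (of_nat (\<Prod>j<i. k - j)) (k - i)"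
proof (induction i)
  case (Suc i)
  then show ?case by (simp add: pderiv_monom algebra_simps)
qed simp

lemma diffop_zero_coeffs:
  assumes "\<And>P. diffop s H P = 0" "l \<le> s"
  shows "H l = 0"
  using assms(2)
proof (induction l rule: less_induct)
  case (less l)
  define P :: mpol where "P = map_matrix (\<lambda>c. monom c l) (mat 1)"
  define c :: complex where "c = of_nat (\<Prod>j<l. l - j)"
  have c: "c \<noteq> 0" unfolding c_def by simp
  have hi: "(map_matrix pderiv ^^ i) P = 0" if "l < i" for i
    unfolding pderiv_iterate
    using that by (auto simp: vec_eq_iff P_def mat_def poly_eq_iff coeff_higher_pderiv)
  have mid: "(map_matrix pderiv ^^ l) P = mat [:c:]"
    unfolding pderiv_iterate
    using pderiv_iterate_monom[of l l]
    by (auto simp: vec_eq_iff P_def mat_def c_def monom_0 poly_eq_iff coeff_higher_pderiv)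
  have "(map_matrix pderiv ^^ i) P ** H i = (if i = l then mat [:c:] ** H l else 0)"
    if "i \<le> s" for i
    using less hi[of i] mid that
    by (cases i l rule: linorder_cases) (auto simp: matrix_matrix_mult_def vec_eq_iff)
  then have "diffop s H P = (\<Sum>i\<le>s. if i = l then mat [:c:] ** H l else 0)"
    unfolding diffop_def by (intro sum.cong) auto
  then have "mat [:c:] ** H l = 0"
    using assms(1)[of P] less.prems by simp
  then show ?case
    using c by (auto simp: vec_eq_iff matrix_matrix_mult_def mat_def if_distrib[of "\<lambda>x. x * _"]
        sum.delta cong: if_cong)
qed

lemma diffop_coeffs_unique:
  assumes "diffop s F = diffop s G" "l \<le> s"
  shows "F l = G l"
proof -
  have "diffop s (\<lambda>i. F i - G i) P = diffop s F P - diffop s G P" for P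
    by (simp add: diffop_def matrix_matrix_mult_def vec_eq_iff right_diff_distrib sum_subtractf)
  then show ?thesis
    using diffop_zero_coeffs[of s "\<lambda>i. F i - G i" l] assms by simp
qed

end

theory Submission
  imports Defs
begin

text \<open>The operator \<open>\<Delta> = D1 + D2\<close> (\<open>Dlt\<close> below) is symmetric and has the scalar leading
  coefficient \<open>q = x^2 - 1\<close>. It acts triangularly on powers of \<open>x\<close> and its eigenvalues in
  different degrees are disjoint, so the monic orthogonal polynomials are its monic eigenpolynomials,
  and relations such as \<open>D1 D2 = 0\<close> show that the four generators act on them by multiples of
  the matrix units. Hence every entry of the eigenvalue of \<open>D\<close> can be isolated as a product
  \<open>L D R\<close> that commutes with \<open>\<Delta>\<close>. The subleading coefficient of this commutation is
  the equation \<open>q g' = (s + 2) x g\<close> for an entry \<open>g\<close> of \<open>T F S\<close>, where \<open>F\<close> is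
  the leading coefficient of \<open>D\<close>, \<open>T = x + J\<close>, \<open>S = x - J\<close> and \<open>J\<close> exchanges the
  coordinates. It forces \<open>s = 2 k\<close> and \<open>q F = q^k S A T\<close> with a constant matrix
  \<open>A\<close>, and for \<open>k > 0\<close> this is the leading coefficient of a combination of the
  \<open>\<Delta>^(k-1) D_i\<close>, which lowers the order. In order zero, \<open>A\<close> commutes with \<open>J\<close>
  and with the constant term of the polynomial of degree one; since \<open>n \<noteq> 2 p\<close>, it is a scalar.\<close>

section \<open>Algebraic relations between the operators\<close>

text \<open>Constants and the variable stay named atoms instead of coefficient lists, so that
  operator identities reduce to differentiation rules and commutative ring normalisation.\<close>

definition cst :: "real \<Rightarrow> complex poly" where
  "cst r = [:complex_of_real r:]"

definition X :: "complex poly" where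
  "X = [:0, 1:]"

lemma cst_simps:
  "cst (a + b) = cst a + cst b" "cst (a - b) = cst a - cst b" "cst (a * b) = cst a * cst b"
  "cst (- a) = - cst a" "cst 0 = 0" "cst 1 = 1" "cst (numeral k) = numeral k"
  by (simp_all add: cst_def numeral_poly)

lemma pderiv_cst [simp]: "pderiv (cst r) = 0"
  by (simp add: cst_def pderiv_pCons)

lemma pderiv_X [simp]: "pderiv X = 1"
  by (simp add: X_def pderiv_pCons)

lemma mat2_nth [simp]:
  "mat2 a b c d $ 1 $ 1 = a" "mat2 a b c d $ 1 $ 2 = b"
  "mat2 a b c d $ 2 $ 1 = c" "mat2 a b c d $ 2 $ 2 = d"
  by (simp_all add: mat2_def)

lemma diffop2_nth:
  "diffop2 F2 F1 F0 P $ i $ j = (\<Sum>k\<in>UNIV.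
      pderiv (pderiv (P $ i $ k)) * map_poly of_real (F2 $ k $ j)
    + pderiv (P $ i $ k) * map_poly of_real (F1 $ k $ j)
    + P $ i $ k * map_poly of_real (F0 $ k $ j))"
  by (simp add: diffop2_def diffop_def numeral_2_eq_2 matrix_matrix_mult_def sum.distrib)

lemma D1_nth:
  "D1 n p P $ i $ 1 = X\<^sup>2 * pderiv (pderiv (P $ i $ 1)) - X * pderiv (pderiv (P $ i $ 2))
     + cst (n + 2) * X * pderiv (P $ i $ 1) - cst p * pderiv (P $ i $ 2)
     + cst (p * (n - p + 1)) * P $ i $ 1"
  "D1 n p P $ i $ 2 = X * pderiv (pderiv (P $ i $ 1)) - pderiv (pderiv (P $ i $ 2))
     + cst (n - p + 2) * pderiv (P $ i $ 1)"
  by (simp_all add: D1_def diffop2_nth sum_2 map_poly_pCons cst_def X_def power2_eq_square algebra_simps)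

lemma D2_nth:
  "D2 n p P $ i $ 1 = X * pderiv (pderiv (P $ i $ 2)) - pderiv (pderiv (P $ i $ 1))
     + cst (p + 2) * pderiv (P $ i $ 2)"
  "D2 n p P $ i $ 2 = X\<^sup>2 * pderiv (pderiv (P $ i $ 2)) - X * pderiv (pderiv (P $ i $ 1))
     + cst (n + 2) * X * pderiv (P $ i $ 2) + cst (p - n) * pderiv (P $ i $ 1)
     + cst ((p + 1) * (n - p)) * P $ i $ 2"
  by (simp_all add: D2_def diffop2_nth sum_2 map_poly_pCons cst_def X_def power2_eq_square algebra_simps)

lemma D3_nth:
  "D3 n p P $ i $ 1 = X\<^sup>2 * pderiv (pderiv (P $ i $ 2)) - X * pderiv (pderiv (P $ i $ 1))
     + cst (2 * (p + 1)) * X * pderiv (P $ i $ 2) - cst p * pderiv (P $ i $ 1)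
     + cst (p * (p + 1)) * P $ i $ 2"
  "D3 n p P $ i $ 2 = X * pderiv (pderiv (P $ i $ 2)) - pderiv (pderiv (P $ i $ 1))
     + cst (p + 2) * pderiv (P $ i $ 2)"
  by (simp_all add: D3_def diffop2_nth sum_2 map_poly_pCons cst_def X_def power2_eq_square algebra_simps)

lemma D4_nth:
  "D4 n p P $ i $ 1 = X * pderiv (pderiv (P $ i $ 1)) - pderiv (pderiv (P $ i $ 2))
     + cst (n - p + 2) * pderiv (P $ i $ 1)"
  "D4 n p P $ i $ 2 = X\<^sup>2 * pderiv (pderiv (P $ i $ 1)) - X * pderiv (pderiv (P $ i $ 2))
     + cst (2 * (n - p + 1)) * X * pderiv (P $ i $ 1) + cst (p - n) * pderiv (P $ i $ 2)
     + cst ((n - p) * (n - p + 1)) * P $ i $ 1"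
  by (simp_all add: D4_def diffop2_nth sum_2 map_poly_pCons cst_def X_def power2_eq_square algebra_simps)

definition Dlt :: "real \<Rightarrow> real \<Rightarrow> mop" where
  "Dlt n p P = D1 n p P + D2 n p P"

lemmas D_nth = D1_nth D2_nth D3_nth D4_nth

lemmas op_identity_simps =
  D_nth Dlt_def vec_eq_iff forall_2 pderiv_add pderiv_diff pderiv_mult power2_eq_square
  cst_simps mat2_nth

text \<open>Operators act on the right, so this is the product D1 D2. The first two vanishing
  products make D1 and D2 commute with \<open>Dlt\<close>; the next two annihilate one row of the
  images under D3 and D4.\<close>

lemma D1_D2: "D2 n p (D1 n p P) = 0"
  by (simp add: op_identity_simps algebra_simps)

lemma D2_D1: "D1 n p (D2 n p P) = 0"
  by (simp add: op_identity_simps algebra_simps)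

lemma D1_D3: "D3 n p (D1 n p P) = 0"
  by (simp add: op_identity_simps algebra_simps)

lemma D2_D4: "D4 n p (D2 n p P) = 0"
  by (simp add: op_identity_simps algebra_simps)

text \<open>D3 and D4 shift eigenvalues of \<open>Dlt\<close> by n - 2 p, down and up respectively.
  This is exactly the gap between its two families of eigenvalues, so they pass from one family to
  the other.\<close>

lemma D3_Dlt: "Dlt n p (D3 n p P) = D3 n p (Dlt n p P) - mat (cst (n - 2 * p)) ** D3 n p P"
  by (simp add: op_identity_simps matrix_matrix_mult_def sum_2 mat_def algebra_simps)

lemma D4_Dlt: "Dlt n p (D4 n p P) = D4 n p (Dlt n p P) + mat (cst (n - 2 * p)) ** D4 n p P"
  by (simp add: op_identity_simps matrix_matrix_mult_def sum_2 mat_def algebra_simps)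

section \<open>Matrix coefficients, constant left factors and degree bounds\<close>

definition dmat :: "(2 \<Rightarrow> 'a::zero) \<Rightarrow> 'a^2^2" where
  "dmat m = (\<chi> i j. if i = j then m i else 0)"

lemma mcoeff_nth [simp]: "mcoeff P k $ i $ j = coeff (P $ i $ j) k"
  by (simp add: mcoeff_def)

lemma mcoeff_add [simp]: "mcoeff (P + Q) k = mcoeff P k + mcoeff Q k"
  and mcoeff_diff [simp]: "mcoeff (P - Q) k = mcoeff P k - mcoeff Q k"
  and mcoeff_zero [simp]: "mcoeff 0 k = 0"
  by (simp_all add: vec_eq_iff)

lemma mpol_eqI: "(\<And>k. mcoeff P k = mcoeff Q k) \<Longrightarrow> P = Q"
  by (simp add: vec_eq_iff poly_eq_iff)

lemma mconst_nth [simp]: "mconst A $ i $ j = [:A $ i $ j:]"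
  by (simp add: mconst_def)

lemma mconst_mult: "mconst (A ** B) = mconst A ** mconst B"
  by (simp add: vec_eq_iff matrix_matrix_mult_def sum_2)

lemma mconst_mat1 [simp]: "mconst (mat 1) = mat 1"
  by (simp add: vec_eq_iff mat_def)

lemma mconst_0 [simp]: "mconst 0 = 0"
  by (simp add: vec_eq_iff)

lemma mconst_add: "mconst (A + B) = mconst A + mconst B"
  by (simp add: vec_eq_iff)

lemma mcoeff_mconst_mult [simp]: "mcoeff (mconst A ** P) k = A ** mcoeff P k"
  by (simp add: vec_eq_iff matrix_matrix_mult_def sum_2)

lemma dmat_mult_nth [simp]: "(dmat m ** A) $ i $ j = m i * A $ i $ j"
  and mult_dmat_nth [simp]: "(A ** dmat m) $ i $ j = A $ i $ j * m j"
  for A :: "'a::semiring_1^2^2"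
  by (simp_all add: dmat_def matrix_matrix_mult_def if_distrib[of "\<lambda>x. x * _"]
      if_distrib[of "\<lambda>x. _ * x"] cong: if_cong)

lemma mconst_dmat: "mconst (dmat m) = dmat (\<lambda>i. [:m i:])"
  by (simp add: dmat_def vec_eq_iff)

lemma pderiv_iterate_mconst:
  "(map_matrix pderiv ^^ i) (mconst A ** P) = mconst A ** (map_matrix pderiv ^^ i) P"
proof (induction i)
  case (Suc i)
  have "map_matrix pderiv (mconst A ** P) = mconst A ** map_matrix pderiv P" for P
    by (simp add: vec_eq_iff matrix_matrix_mult_def sum_2 pderiv_add pderiv_smult)
  then show ?case using Suc by simp
qed simp

lemma pderiv_iterate_add:
  "(map_matrix pderiv ^^ i) (P + Q) =
    (map_matrix pderiv ^^ i) P + (map_matrix pderiv ^^ i) Q" for P Q :: mpol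
proof (induction i)
  case (Suc i)
  have "map_matrix pderiv (P + Q) = map_matrix pderiv P + map_matrix pderiv Q" for P Q :: mpol
    by (simp add: vec_eq_iff pderiv_add)
  then show ?case using Suc by simp
qed simp

lemma matrix_sum_left: "A ** (\<Sum>i\<in>S. f i) = (\<Sum>i\<in>S. A ** f i)"
  for A :: "'a::comm_semiring_1^'n^'m"
  by (induction S rule: infinite_finite_induct) (simp_all add: matrix_add_ldistrib)

lemma matrix_add_rdistrib: "(A + B) ** C = A ** C + B ** C"
  for A B :: "'a::semiring_1^'n^'m"
  by (simp add: vec_eq_iff matrix_matrix_mult_def distrib_right sum.distrib)

lemma diffop_mconst: "diffop s F (mconst A ** P) = mconst A ** diffop s F P"
  by (simp add: diffop_def pderiv_iterate_mconst matrix_mul_assoc matrix_sum_left)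

lemma diffop_add: "diffop s F (P + Q) = diffop s F P + diffop s F Q"
  by (simp add: diffop_def pderiv_iterate_add matrix_add_rdistrib sum.distrib)

lemma D_mconst:
  "D1 n p (mconst A ** P) = mconst A ** D1 n p P"
  "D2 n p (mconst A ** P) = mconst A ** D2 n p P"
  "D3 n p (mconst A ** P) = mconst A ** D3 n p P"
  "D4 n p (mconst A ** P) = mconst A ** D4 n p P"
  by (simp_all add: D1_def D2_def D3_def D4_def diffop2_def diffop_mconst)

lemma D_add:
  "D1 n p (P + Q) = D1 n p P + D1 n p Q" "D2 n p (P + Q) = D2 n p P + D2 n p Q"
  "D3 n p (P + Q) = D3 n p P + D3 n p Q" "D4 n p (P + Q) = D4 n p P + D4 n p Q"
  by (simp_all add: D1_def D2_def D3_def D4_def diffop2_def diffop_add)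

lemma Dlt_mconst: "Dlt n p (mconst A ** P) = mconst A ** Dlt n p P"
  by (simp add: Dlt_def D_mconst matrix_add_ldistrib)

lemma Dlt_add: "Dlt n p (P + Q) = Dlt n p P + Dlt n p Q"
  by (simp add: Dlt_def D_add)

lemma Dlt_diff: "Dlt n p (P - Q) = Dlt n p P - Dlt n p Q"
  using Dlt_add[of n p "P - Q" Q] by simp

text \<open>A strict bound also covers the zero matrix, for which \<open>mdegree\<close> would be
  the maximum of an empty set.\<close>

definition mdeg_lt :: "mpol \<Rightarrow> nat \<Rightarrow> bool" where
  "mdeg_lt P w \<longleftrightarrow> (\<forall>k\<ge>w. mcoeff P k = 0)"

lemma mdeg_lt_coeff: "mdeg_lt P w \<Longrightarrow> w \<le> k \<Longrightarrow> coeff (P $ i $ j) k = 0"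
  unfolding mdeg_lt_def by (metis mcoeff_nth zero_index)

lemma mdeg_ltI: "(\<And>k i j. w \<le> k \<Longrightarrow> coeff (P $ i $ j) k = 0) \<Longrightarrow> mdeg_lt P w"
  by (simp add: mdeg_lt_def vec_eq_iff)

lemma mdeg_lt_0 [simp]: "mdeg_lt P 0 \<longleftrightarrow> P = 0"
  by (auto simp: mdeg_lt_def intro: mpol_eqI)

lemma mdeg_lt_add: "mdeg_lt P w \<Longrightarrow> mdeg_lt Q w \<Longrightarrow> mdeg_lt (P + Q) w"
  and mdeg_lt_diff: "mdeg_lt P w \<Longrightarrow> mdeg_lt Q w \<Longrightarrow> mdeg_lt (P - Q) w"
  and mdeg_lt_mconst: "mdeg_lt P w \<Longrightarrow> mdeg_lt (mconst A ** P) w"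
  and mdeg_lt_mono: "mdeg_lt P w \<Longrightarrow> w \<le> v \<Longrightarrow> mdeg_lt P v"
  by (simp_all add: mdeg_lt_def)

lemma mdeg_lt_Suc: "mdeg_lt P (Suc w) \<Longrightarrow> mcoeff P w = 0 \<Longrightarrow> mdeg_lt P w"
  unfolding mdeg_lt_def using Suc_leI le_neq_implies_less by blast

lemma mdeg_lt_exists: "\<exists>w. mdeg_lt P w"
proof -
  have "coeff (P $ i $ j) k = 0"
    if "k > (\<Sum>i\<in>UNIV. \<Sum>j\<in>UNIV. degree (P $ i $ j))" for i j k
    using that exhaust_2[of i] exhaust_2[of j] by (intro coeff_eq_0) (auto simp: sum_2)
  then have "mdeg_lt P (Suc (\<Sum>i\<in>UNIV. \<Sum>j\<in>UNIV. degree (P $ i $ j)))"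
    by (intro mdeg_ltI) (simp add: Suc_le_eq)
  then show ?thesis ..
qed

lemma mdegree_eqI:
  assumes "mdeg_lt P (Suc w)" "mcoeff P w \<noteq> 0"
  shows "mdegree P = w"
  unfolding mdegree_def
proof (rule Max_eqI)
  have *: "k \<le> w" if "mcoeff P k \<noteq> 0" for k
    using assms(1) that unfolding mdeg_lt_def by (metis not_less_eq_eq)
  show "finite {k. mcoeff P k \<noteq> 0}"
    by (rule finite_subset[of _ "{..w}"]) (use * in auto)
qed (use assms in \<open>auto simp: mdeg_lt_def not_less_eq_eq[symmetric]\<close>)

lemma mmonic_iff: "mmonic w P \<longleftrightarrow> mdeg_lt P (Suc w) \<and> mcoeff P w = mat 1"
proof
  assume P: "mmonic w P"
  obtain v where v: "mdeg_lt P v" using mdeg_lt_exists by blast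
  have "finite {k. mcoeff P k \<noteq> 0}"
    by (rule finite_subset[of _ "{..<v}"]) (use v in \<open>force simp: mdeg_lt_def not_le[symmetric]\<close>)+
  then have "k \<le> w" if "mcoeff P k \<noteq> 0" for k
    using P that unfolding mmonic_def mdegree_def by (metis Max_ge mem_Collect_eq)
  then show "mdeg_lt P (Suc w) \<and> mcoeff P w = mat 1"
    using P unfolding mmonic_def mdeg_lt_def by (metis not_less_eq_eq)
next
  assume P: "mdeg_lt P (Suc w) \<and> mcoeff P w = mat 1"
  then have "mcoeff P w \<noteq> 0" by (simp add: vec_eq_iff mat_def)
  with P show "mmonic w P" by (simp add: mmonic_def mdegree_eqI)
qed

lemma coeff_X_mult: "coeff (X * f) k = (if k = 0 then 0 else coeff f (k - 1))"
  by (cases k) (simp_all add: X_def)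

lemma coeff_ops:
  "coeff (cst r * f) k = of_real r * coeff f k"
  "coeff (cst r * X * pderiv f) k = of_real r * (of_nat k * coeff f k)"
  "coeff (X * pderiv (pderiv f)) k = of_nat k * of_nat (k + 1) * coeff f (k + 1)"
  "coeff (X\<^sup>2 * pderiv (pderiv f)) k = of_nat k * (of_nat k - 1) * coeff f k"
proof -
  show *: "coeff (cst r * f) k = of_real r * coeff f k" for f k by (simp add: cst_def)
  show "coeff (X * pderiv (pderiv f)) k = of_nat k * of_nat (k + 1) * coeff f (k + 1)"
    by (cases k) (simp_all add: coeff_X_mult coeff_pderiv)
  show "coeff (cst r * X * pderiv f) k = of_real r * (of_nat k * coeff f k)"
    by (cases k) (simp_all add: * mult.assoc coeff_X_mult coeff_pderiv)
  show "coeff (X\<^sup>2 * pderiv (pderiv f)) k = of_nat k * (of_nat k - 1) * coeff f k"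
    by (cases k) (auto simp: power2_eq_square mult.assoc coeff_X_mult coeff_pderiv split: nat_diff_split)
qed

text \<open>The factor by which \<open>Dlt\<close> multiplies the coefficient of x^w in column i of
  a matrix polynomial of degree at most w.\<close>

definition mu :: "real \<Rightarrow> real \<Rightarrow> 2 \<Rightarrow> nat \<Rightarrow> real" where
  "mu n p i w = (if i = 1 then (w + p) * (w + n - p + 1) else (w + p + 1) * (w + n - p))"

text \<open>Terms of the operators that lower the degree only see coefficients of P beyond w, which
  vanish. Admitting every k \<ge> w yields the top coefficient and the degree bound of the image at
  once.\<close>

lemma
  assumes "mdeg_lt P (Suc w)" "w \<le> k"
  shows coeff_D1: "coeff (D1 n p P $ i $ 1) k = mu n p 1 k * coeff (P $ i $ 1) k"
      "coeff (D1 n p P $ i $ 2) k = 0"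
    and coeff_D2: "coeff (D2 n p P $ i $ 1) k = 0"
      "coeff (D2 n p P $ i $ 2) k = mu n p 2 k * coeff (P $ i $ 2) k"
    and coeff_D3: "coeff (D3 n p P $ i $ 1) k = (k + p) * (k + p + 1) * coeff (P $ i $ 2) k"
      "coeff (D3 n p P $ i $ 2) k = 0"
    and coeff_D4: "coeff (D4 n p P $ i $ 1) k = 0"
      "coeff (D4 n p P $ i $ 2) k = (k + n - p) * (k + n - p + 1) * coeff (P $ i $ 1) k"
  using assms
  by (simp_all add: D_nth coeff_ops mdeg_lt_coeff coeff_pderiv mu_def)
    (simp_all add: algebra_simps)

lemma mdeg_lt_D:
  assumes "mdeg_lt P (Suc w)"
  shows "mdeg_lt (D1 n p P) (Suc w)" "mdeg_lt (D2 n p P) (Suc w)"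
    "mdeg_lt (D3 n p P) (Suc w)" "mdeg_lt (D4 n p P) (Suc w)"
  using mdeg_lt_coeff[OF assms] coeff_D1[OF assms] coeff_D2[OF assms] coeff_D3[OF assms]
    coeff_D4[OF assms]
  by (simp_all add: mdeg_lt_def vec_eq_iff forall_2)

section \<open>Triangularity and eigenpolynomials\<close>

lemma matrix_diff_ldistrib: "A ** (B - C) = A ** B - A ** C"
  for A :: "'a::ring_1^'n^'m"
  by (simp add: vec_eq_iff matrix_matrix_mult_def right_diff_distrib sum_subtractf)

lemma mat_mult_nth: "(mat f ** P) $ i $ j = f * P $ i $ j"
  for P :: "'a::semiring_1^2^2"
  by (simp add: matrix_matrix_mult_def mat_def if_distrib[of "\<lambda>x. x * _"] cong: if_cong)

lemma coeff_Dlt: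
  assumes "mdeg_lt P (Suc w)" "w \<le> k"
  shows "coeff (Dlt n p P $ i $ j) k = mu n p j k * coeff (P $ i $ j) k"
proof -
  have "j = 1 \<or> j = 2" using exhaust_2 by blast
  then show ?thesis
    by (auto simp: Dlt_def coeff_D1[OF assms] coeff_D2[OF assms])
qed

lemma mcoeff_Dlt:
  assumes "mdeg_lt P (Suc w)"
  shows "mcoeff (Dlt n p P) w = mcoeff P w ** dmat (\<lambda>j. of_real (mu n p j w))"
  by (simp add: vec_eq_iff coeff_Dlt[OF assms])

lemma Dlt_0 [simp]: "Dlt n p 0 = 0"
  by (metis Dlt_diff diff_self)

lemma mdeg_lt_Dlt: "mdeg_lt P w \<Longrightarrow> mdeg_lt (Dlt n p P) w"
  by (cases w) (simp, simp add: Dlt_def mdeg_lt_add mdeg_lt_D)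

text \<open>Descent on the degree bound: in the equation for the top coefficient, entry (i, j) is
  multiplied by \<open>mu n p j k\<close> on one side and by \<open>m i\<close> on the other, so it
  is zero.\<close>

lemma Dlt_eq_0:
  assumes "mdeg_lt P k" and eigen: "Dlt n p P = mconst (dmat m) ** P"
    and "\<And>l i j. l < k \<Longrightarrow> m i \<noteq> of_real (mu n p j l)"
  shows "P = 0"
  using assms(1,3)
proof (induction k)
  case (Suc k)
  have "mcoeff P k $ i $ j = 0" for i j
  proof -
    have "mcoeff (Dlt n p P) k $ i $ j = (dmat m ** mcoeff P k) $ i $ j"
      by (simp add: eigen)
    then have "of_real (mu n p j k) * coeff (P $ i $ j) k = m i * coeff (P $ i $ j) k"
      by (simp add: coeff_Dlt[OF Suc.prems(1)])
    then show ?thesis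
      using Suc.prems(2)[OF lessI, of i j] by (metis mcoeff_nth mult_right_cancel)
  qed
  then have "mdeg_lt P k"
    using Suc.prems(1) by (metis mdeg_lt_Suc vec_eq_iff zero_index)
  then show ?case
    by (intro Suc.IH Suc.prems(2)) simp_all
qed simp

lemma Dlt_solvable:
  assumes "mdeg_lt R k" "\<And>l i j. l < k \<Longrightarrow> m i \<noteq> of_real (mu n p j l)"
  shows "\<exists>P. mdeg_lt P k \<and> Dlt n p P - mconst (dmat m) ** P = R"
  using assms
proof (induction k arbitrary: R)
  case 0
  then show ?case by (intro exI[of _ 0]) simp
next
  case (Suc k)
  \<comment> \<open>The monomial part of the solution that cancels the top coefficient of R; the
    denominators are nonzero by the assumption on \<open>m\<close>. The remainder \<open>R'\<close>
    has lower degree.\<close>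
  define P0 :: mpol where
    "P0 = (\<chi> i j. monom (coeff (R $ i $ j) k / (of_real (mu n p j k) - m i)) k)"
  define R' where "R' = R - (Dlt n p P0 - mconst (dmat m) ** P0)"
  have P0: "mdeg_lt P0 (Suc k)"
    by (rule mdeg_ltI) (simp add: P0_def)
  have "of_real (mu n p j k) * coeff (P0 $ i $ j) k
      = coeff (R $ i $ j) k + m i * coeff (P0 $ i $ j) k" for i j
    using Suc.prems(2)[of k i j] by (simp add: P0_def field_simps)
  then have "mcoeff R' k = 0"
    by (simp add: R'_def vec_eq_iff coeff_Dlt[OF P0] mconst_dmat)
  moreover have "mdeg_lt R' (Suc k)"
    unfolding R'_def by (intro mdeg_lt_diff Suc.prems mdeg_lt_Dlt mdeg_lt_mconst P0)
  ultimately obtain P where P: "mdeg_lt P k" "Dlt n p P - mconst (dmat m) ** P = R'"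
    using Suc.IH[of R'] Suc.prems(2) by (metis less_Suc_eq mdeg_lt_Suc)
  have "mdeg_lt (P + P0) (Suc k)"
    using P(1) P0 by (intro mdeg_lt_add) (auto intro: mdeg_lt_mono)
  moreover have "Dlt n p (P + P0) - mconst (dmat m) ** (P + P0) = R"
    using P(2) by (simp add: R'_def Dlt_add matrix_add_ldistrib algebra_simps)
  ultimately show ?case by blast
qed

section \<open>Monic eigenpolynomials and the eigenvalues of the generators\<close>

locale gegenbauer_weight =
  fixes n p :: real
  assumes p_pos: "0 < p" and p_less: "p < n / 2"
begin

lemma mu_pos: "mu n p i w > 0"
  using p_pos p_less by (simp add: mu_def add_pos_pos add_nonneg_pos)

lemma mu_2: "mu n p 2 w = mu n p 1 w + (n - 2 * p)"
  by (simp add: mu_def algebra_simps)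

text \<open>Consecutive eigenvalues of one kind differ by more than \<open>n\<close>, the two kinds by \<open>n - 2 * p\<close>.\<close>

lemma mu_less:
  assumes "l < w"
  shows "mu n p i l < mu n p j w"
proof -
  have *: "mu n p 1 w - mu n p 1 l = (real w - real l) * (real w + real l + n + 1)"
    by (simp add: mu_def algebra_simps)
  have "1 * (n + 1) \<le> (real w - real l) * (real w + real l + n + 1)"
    using assms p_pos p_less by (intro mult_mono) auto
  then have "mu n p 1 l + n < mu n p 1 w" using * by simp
  then show ?thesis
    using p_pos p_less mu_2[of l] mu_2[of w] exhaust_2[of i] exhaust_2[of j] by auto
qed

lemma mu_neq: "l < w \<Longrightarrow> mu n p j w \<noteq> mu n p i l"
  using mu_less by (metis less_irrefl)

definition Qe :: "nat \<Rightarrow> mpol" where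
  "Qe w = (SOME Q. mmonic w Q \<and> Dlt n p Q = mconst (dmat (\<lambda>i. of_real (mu n p i w))) ** Q)"

text \<open>For x^w times the identity the eigenvalue equation fails only in degrees below w. A
  correction of degree below w exists because eigenvalues of degree w do not occur in lower
  degrees.\<close>

lemma Qe: "mmonic w (Qe w)"
  and Dlt_Qe: "Dlt n p (Qe w) = mconst (dmat (\<lambda>i. of_real (mu n p i w))) ** Qe w"
proof -
  let ?M = "dmat (\<lambda>i. complex_of_real (mu n p i w))"
  define P0 :: mpol where "P0 = (\<chi> i j. if i = j then monom 1 w else 0)"
  define R where "R = mconst ?M ** P0 - Dlt n p P0"
  have P0: "mdeg_lt P0 (Suc w)" "mcoeff P0 w = mat 1"
    by (auto intro!: mdeg_ltI simp: P0_def vec_eq_iff mat_def)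
  have "mdeg_lt R (Suc w)"
    unfolding R_def by (intro mdeg_lt_diff mdeg_lt_mconst mdeg_lt_Dlt P0)
  moreover have "mcoeff R w = 0"
    by (simp add: R_def mcoeff_Dlt P0)
  ultimately have "mdeg_lt R w" by (rule mdeg_lt_Suc)
  then have "\<exists>P. mdeg_lt P w \<and> Dlt n p P - mconst ?M ** P = R"
    by (rule Dlt_solvable) (simp add: mu_neq)
  then obtain P where P: "mdeg_lt P w" "Dlt n p P - mconst ?M ** P = R" by blast
  have "mmonic w (P + P0)"
    using P(1) P0 by (auto simp: mmonic_iff mdeg_lt_def)
  moreover have "Dlt n p (P + P0) = mconst ?M ** (P + P0)"
    using P(2) by (simp add: R_def Dlt_add matrix_add_ldistrib algebra_simps)
  ultimately have "\<exists>Q. mmonic w Q \<and> Dlt n p Q = mconst ?M ** Q" by blast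
  from someI_ex[OF this] show "mmonic w (Qe w)" "Dlt n p (Qe w) = mconst ?M ** Qe w"
    by (auto simp: Qe_def)
qed

lemma Qe_deg: "mdeg_lt (Qe w) (Suc w)" and Qe_lead: "mcoeff (Qe w) w = mat 1"
  using Qe by (auto simp: mmonic_iff)

text \<open>The difference of the two sides has degree below w and is again an eigenpolynomial for
  \<open>m\<close>, since the top coefficient intertwines the two diagonal matrices; hence it
  vanishes. Leaving \<open>m\<close> free allows the interchanged eigenvalues needed for D3 and
  D4.\<close>

lemma Dlt_eigen_eq_Qe:
  assumes P: "mdeg_lt P (Suc w)" "Dlt n p P = mconst (dmat m) ** P"
    and m: "\<And>l i j. l < w \<Longrightarrow> m i \<noteq> of_real (mu n p j l)"
  shows "P = mconst (mcoeff P w) ** Qe w"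
proof -
  let ?M = "dmat (\<lambda>i. complex_of_real (mu n p i w))"
  define R where "R = P - mconst (mcoeff P w) ** Qe w"
  have "mdeg_lt R w"
    unfolding R_def
    by (rule mdeg_lt_Suc) (simp_all add: mdeg_lt_diff mdeg_lt_mconst P Qe_deg Qe_lead)
  moreover have "Dlt n p R = mconst (dmat m) ** R"
  proof -
    have "mcoeff P w ** ?M = dmat m ** mcoeff P w"
      by (metis P mcoeff_Dlt mcoeff_mconst_mult)
    then have "mconst (mcoeff P w) ** (mconst ?M ** Qe w) =
        mconst (dmat m) ** (mconst (mcoeff P w) ** Qe w)"
      by (metis matrix_mul_assoc mconst_mult)
    then show ?thesis
      by (simp only: R_def Dlt_diff Dlt_mconst Dlt_Qe P(2) matrix_diff_ldistrib)
  qed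
  ultimately have "R = 0"
    by (rule Dlt_eq_0) (rule m)
  then show ?thesis by (simp add: R_def)
qed

text \<open>As D1 commutes with \<open>Dlt\<close>, the image of \<open>Qe w\<close> is an
  eigenpolynomial with the same row eigenvalues, hence a left multiple of \<open>Qe w\<close>; the
  factor is its top coefficient.\<close>

lemma D1_Qe: "D1 n p (Qe w) = mconst (mat2 (of_real (mu n p 1 w)) 0 0 0) ** Qe w"
proof -
  have "Dlt n p (D1 n p (Qe w)) = D1 n p (Dlt n p (Qe w))"
    using D1_D2 D2_D1 by (simp add: Dlt_def D_add)
  then have "D1 n p (Qe w) = mconst (mcoeff (D1 n p (Qe w)) w) ** Qe w"
    by (intro Dlt_eigen_eq_Qe[where m = "\<lambda>i. of_real (mu n p i w)"])
      (simp_all add: mdeg_lt_D Qe_deg Dlt_Qe D_mconst mu_neq)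
  moreover have "mcoeff (D1 n p (Qe w)) w = mat2 (of_real (mu n p 1 w)) 0 0 0"
    using Qe_lead[of w] by (simp add: vec_eq_iff forall_2 coeff_D1[OF Qe_deg] mat_def)
  ultimately show ?thesis by simp
qed

lemma D2_Qe: "D2 n p (Qe w) = mconst (mat2 0 0 0 (of_real (mu n p 2 w))) ** Qe w"
proof -
  have "Dlt n p (D2 n p (Qe w)) = D2 n p (Dlt n p (Qe w))"
    using D1_D2 D2_D1 by (simp add: Dlt_def D_add)
  then have "D2 n p (Qe w) = mconst (mcoeff (D2 n p (Qe w)) w) ** Qe w"
    by (intro Dlt_eigen_eq_Qe[where m = "\<lambda>i. of_real (mu n p i w)"])
      (simp_all add: mdeg_lt_D Qe_deg Dlt_Qe D_mconst mu_neq)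
  moreover have "mcoeff (D2 n p (Qe w)) w = mat2 0 0 0 (of_real (mu n p 2 w))"
    using Qe_lead[of w] by (simp add: vec_eq_iff forall_2 coeff_D2[OF Qe_deg] mat_def)
  ultimately show ?thesis by simp
qed

lemma D3_Qe: "D3 n p (Qe w) = mconst (mat2 0 0 (of_real ((w + p) * (w + p + 1))) 0) ** Qe w"
proof -
  define P where "P = D3 n p (Qe w)"
  \<comment> \<open>The two eigenvalues are interchanged. Row 1 of P turns out to be zero, and its
    value of \<open>m\<close> is chosen to avoid the eigenvalues of lower degree.\<close>
  define m where "m = (\<lambda>i :: 2. complex_of_real (mu n p (if i = 1 then 2 else 1) w))"
  \<comment> \<open>Since D1 D3 = 0 and D1 multiplies row 1 of \<open>Qe w\<close> by a positive
    number, row 1 of P vanishes. Row 2 then has eigenvalue \<open>mu n p 2 w\<close> - (n - 2 p),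
    which is \<open>mu n p 1 w\<close>.\<close>
  have "mconst (mat2 (of_real (mu n p 1 w)) 0 0 0) ** P = 0"
    using D1_D3[of n p "Qe w"] by (simp add: D1_Qe D_mconst P_def)
  then have P1: "P $ 1 $ j = 0" for j
    using mu_pos[of 1 w] exhaust_2[of j]
    by (auto simp: vec_eq_iff forall_2 matrix_matrix_mult_def sum_2)
  have "Dlt n p P = mconst (dmat (\<lambda>i. of_real (mu n p i w))) ** P - mat (cst (n - 2 * p)) ** P"
    by (simp add: P_def D3_Dlt Dlt_Qe D_mconst)
  also have "\<dots> = mconst (dmat m) ** P"
    by (simp add: vec_eq_iff forall_2 P1 mat_mult_nth mconst_dmat m_def mu_2 cst_def[symmetric]
        cst_simps algebra_simps del: mult_pCons_left)
  finally have "P = mconst (mcoeff P w) ** Qe w"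
    by (intro Dlt_eigen_eq_Qe[where m = m])
      (simp_all add: P_def mdeg_lt_D Qe_deg m_def mu_neq)
  moreover have "mcoeff P w = mat2 0 0 (of_real ((w + p) * (w + p + 1))) 0"
    using Qe_lead[of w] unfolding P_def
    by (simp add: vec_eq_iff forall_2 coeff_D3[OF Qe_deg] mat_def)
  ultimately show ?thesis by (simp add: P_def)
qed

lemma D4_Qe: "D4 n p (Qe w) = mconst (mat2 0 (of_real ((w + n - p) * (w + n - p + 1))) 0 0) ** Qe w"
proof -
  define P where "P = D4 n p (Qe w)"
  define m where "m = (\<lambda>i :: 2. complex_of_real (mu n p (if i = 1 then 2 else 1) w))"
  have "mconst (mat2 0 0 0 (of_real (mu n p 2 w))) ** P = 0"
    using D2_D4[of n p "Qe w"] by (simp add: D2_Qe D_mconst P_def)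
  then have P2: "P $ 2 $ j = 0" for j
    using mu_pos[of 2 w] exhaust_2[of j]
    by (auto simp: vec_eq_iff forall_2 matrix_matrix_mult_def sum_2)
  have "Dlt n p P = mconst (dmat (\<lambda>i. of_real (mu n p i w))) ** P + mat (cst (n - 2 * p)) ** P"
    by (simp add: P_def D4_Dlt Dlt_Qe D_mconst)
  also have "\<dots> = mconst (dmat m) ** P"
    by (simp add: vec_eq_iff forall_2 P2 mat_mult_nth mconst_dmat m_def mu_2 cst_def[symmetric]
        cst_simps algebra_simps del: mult_pCons_left)
  finally have "P = mconst (mcoeff P w) ** Qe w"
    by (intro Dlt_eigen_eq_Qe[where m = m])
      (simp_all add: P_def mdeg_lt_D Qe_deg m_def mu_neq)
  moreover have "mcoeff P w = mat2 0 (of_real ((w + n - p) * (w + n - p + 1))) 0 0"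
    using Qe_lead[of w] unfolding P_def
    by (simp add: vec_eq_iff forall_2 coeff_D4[OF Qe_deg] mat_def)
  ultimately show ?thesis by (simp add: P_def)
qed

end

section \<open>The scalar weight\<close>

lemma poly_eq_0_if_real_interval:
  fixes q :: "complex poly"
  assumes "a < b" "\<And>x. x \<in> {a..b} \<Longrightarrow> poly q (of_real x) = 0"
  shows "q = 0"
proof (rule ccontr)
  assume "q \<noteq> 0"
  then have "finite {z. poly q z = 0}" by (rule poly_roots_finite)
  moreover have "complex_of_real ` {a..b} \<subseteq> {z. poly q z = 0}"
    using assms by auto
  ultimately have "finite (complex_of_real ` {a..b})" by (rule rev_finite_subset)
  then have "finite {a..b}" by (rule finite_imageD) (simp add: inj_on_def)
  then show False using infinite_Icc[OF \<open>a < b\<close>] by simp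
qed

text \<open>For negative a the weight is singular at both endpoints. The substitution t = (x + 1) /
  2 turns it into 4^a times the integrand of a Beta integral.\<close>

lemma powr_weight_integrable:
  fixes a :: real
  assumes "a > -1"
  shows "(\<lambda>x. (1 - x\<^sup>2) powr a) integrable_on {-1..1}"
proof -
  have "(\<lambda>t. t powr (a + 1 - 1) * (1 - t) powr (a + 1 - 1)) integrable_on {0..1::real}"
    using assms by (intro integrable_Beta') auto
  then obtain i where "((\<lambda>t. t powr a * (1 - t) powr a) has_integral i) (cbox 0 (1::real))"
    by (auto simp: integrable_on_def)
  from has_integral_affinity'[OF this, of "1/2" "1/2"]
  have "(\<lambda>x. (x / 2 + 1 / 2) powr a * (1 - (x / 2 + 1 / 2)) powr a) integrable_on {-1..1}"
    by (auto simp: integrable_on_def algebra_simps)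
  then have "(\<lambda>x. 4 powr a * ((x / 2 + 1 / 2) powr a * (1 - (x / 2 + 1 / 2)) powr a))
      integrable_on {-1..1}"
    by (rule integrable_on_mult_right)
  moreover have "4 powr a * ((x / 2 + 1 / 2) powr a * (1 - (x / 2 + 1 / 2)) powr a) = (1 - x\<^sup>2) powr a"
    if "x \<in> {-1..1}" for x
  proof -
    have "4 powr a * ((x / 2 + 1 / 2) powr a * (1 - (x / 2 + 1 / 2)) powr a)
        = (4 * ((x / 2 + 1 / 2) * (1 - (x / 2 + 1 / 2)))) powr a"
      using that by (simp add: powr_mult)
    also have "4 * ((x / 2 + 1 / 2) * (1 - (x / 2 + 1 / 2))) = 1 - x\<^sup>2"
      by (simp add: field_simps power2_eq_square)
    finally show ?thesis .
  qed
  ultimately show ?thesis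
    by (rule integrable_eq)
qed

lemma powr_weight_poly_integrable:
  fixes a :: real
  assumes "a > -1"
  shows "(\<lambda>x. (1 - x\<^sup>2) powr a *\<^sub>R poly h (complex_of_real x)) integrable_on {-1..1}"
proof -
  have c: "continuous_on {-1..1} (\<lambda>x. poly h (complex_of_real x))"
    by (intro continuous_intros)
  have w: "(\<lambda>x. (1 - x\<^sup>2) powr a) absolutely_integrable_on {-1..1}"
    by (rule nonnegative_absolutely_integrable_1[OF powr_weight_integrable[OF assms]]) simp
  have "bilinear (\<lambda>(z::complex) (r::real). r *\<^sub>R z)"
    by (simp add: bilinear_def linear_iff scaleR_right_distrib scaleR_left_distrib)
  from absolutely_integrable_bounded_measurable_product[OF this _ _ _ w, of "\<lambda>x. poly h (of_real x)"]
  have "(\<lambda>x. (1 - x\<^sup>2) powr a *\<^sub>R poly h (complex_of_real x)) absolutely_integrable_on {-1..1}"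
    using continuous_imp_measurable_on_sets_lebesgue[OF c]
      compact_imp_bounded[OF compact_continuous_image[OF c]] by simp
  then show ?thesis
    by (rule set_lebesgue_integral_eq_integral(1))
qed

definition wint :: "real \<Rightarrow> complex poly \<Rightarrow> complex" where
  "wint n h = integral {-1..1} (\<lambda>x. (1 - x\<^sup>2) powr (n / 2 - 1) *\<^sub>R poly h (complex_of_real x))"

context
  fixes n :: real
  assumes n: "n > 0"
begin

lemma wint_add: "wint n (g + h) = wint n g + wint n h"
  unfolding wint_def using n
  by (subst integral_add[symmetric])
    (auto intro!: powr_weight_poly_integrable simp: scaleR_right_distrib)

lemma wint_smult: "wint n (smult c h) = c * wint n h"
  unfolding wint_def by (subst integral_mult_right[symmetric]) (simp add: algebra_simps)

lemma wint_diff: "wint n (g - h) = wint n g - wint n h"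
  using wint_add[of "g - h" h] by simp

text \<open>The integrand is the derivative of (1 - x^2)^(n/2) h, which vanishes at both endpoints
  because n > 0. The derivative is taken only in the open interval, where the weight is
  regular.\<close>

lemma wint_parts: "wint n ((1 - X\<^sup>2) * pderiv h - cst n * X * h) = 0"
proof -
  let ?F = "\<lambda>x. (1 - x\<^sup>2) powr (n / 2) *\<^sub>R poly h (complex_of_real x)"
  let ?f = "\<lambda>x. (1 - x\<^sup>2) powr (n / 2 - 1) *\<^sub>R
      poly ((1 - X\<^sup>2) * pderiv h - cst n * X * h) (complex_of_real x)"
  have "(?f has_integral ?F 1 - ?F (-1)) {-1..1}"
  proof (rule fundamental_theorem_of_calculus_interior)
    show "continuous_on {-1..1} ?F"
      using n by (intro continuous_intros continuous_on_powr')
        (auto simp: abs_square_le_1 abs_le_iff)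
    fix x :: real
    assume x: "x \<in> {-1<..<1}"
    then have pos: "1 - x\<^sup>2 > 0" by (simp add: abs_square_less_1 abs_less_iff)
    have "((\<lambda>x. (1 - x\<^sup>2) powr (n / 2)) has_real_derivative
        (n / 2) * (1 - x\<^sup>2) powr (n / 2 - 1) * (- 2 * x)) (at x)"
      using pos by (auto intro!: derivative_eq_intros simp: powr_diff)
    moreover have "((\<lambda>x. poly h (complex_of_real x)) has_vector_derivative
        poly (pderiv h) (of_real x)) (at x)"
      by (intro has_vector_derivative_real_field poly_DERIV)
    ultimately have "(?F has_vector_derivative
        (1 - x\<^sup>2) powr (n / 2) *\<^sub>R poly (pderiv h) (of_real x)
        + ((n / 2) * (1 - x\<^sup>2) powr (n / 2 - 1) * (- 2 * x)) *\<^sub>R poly h (of_real x)) (at x)"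
      by (rule has_vector_derivative_scaleR)
    also have "(1 - x\<^sup>2) powr (n / 2) *\<^sub>R poly (pderiv h) (of_real x)
        = (1 - x\<^sup>2) powr (n / 2 - 1) *\<^sub>R ((1 - x\<^sup>2) *\<^sub>R poly (pderiv h) (of_real x))"
      using pos by (simp add: powr_diff)
    also have "\<dots> + ((n / 2) * (1 - x\<^sup>2) powr (n / 2 - 1) * (- 2 * x)) *\<^sub>R poly h (of_real x) = ?f x"
      by (simp add: X_def cst_def scaleR_conv_of_real algebra_simps power2_eq_square)
    finally show "(?F has_vector_derivative ?f x) (at x)" .
  qed simp
  then show ?thesis
    using n by (simp add: wint_def integral_unique)
qed

text \<open>On the inner interval the weight is continuous and positive, so a nonnegative integrand
  with zero integral vanishes pointwise. This avoids the endpoints and still suffices to determine a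
  polynomial.\<close>

lemma wint_eq_0:
  assumes "wint n h = 0" "\<And>x. x \<in> {-1..1} \<Longrightarrow> Re (poly h (of_real x)) \<ge> 0"
    and x: "x \<in> {-1/2..1/2}"
  shows "Re (poly h (of_real x)) = 0"
proof -
  let ?g = "\<lambda>x. (1 - x\<^sup>2) powr (n / 2 - 1) * Re (poly h (complex_of_real x))"
  have pos: "1 - x\<^sup>2 > 0" if "x \<in> {-1/2..1/2}" for x :: real
    using that by (simp add: abs_square_less_1 abs_less_iff)
  have "((\<lambda>x. (1 - x\<^sup>2) powr (n / 2 - 1) *\<^sub>R poly h (complex_of_real x)) has_integral 0) {-1..1}"
    using integrable_integral[OF powr_weight_poly_integrable[of "n / 2 - 1" h]] assms(1) n
    unfolding wint_def by simp
  from has_integral_Re[OF this] have g: "(?g has_integral 0) {-1..1}" by simp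
  have c: "continuous_on {-1/2..1/2} ?g"
    using pos by (intro continuous_intros) force+
  have "integral {-1/2..1/2} ?g \<le> integral {-1..1} ?g"
    using assms(2) g
    by (intro integral_subset_le integrable_continuous_real[OF c] has_integral_integrable[OF g]) auto
  moreover have "integral {-1/2..1/2} ?g \<ge> 0"
    using assms(2) by (intro integral_nonneg integrable_continuous_real c) auto
  ultimately have "integral {-1/2..1/2} ?g = 0"
    using g by (simp add: integral_unique)
  then have "?g x = 0"
    using integral_eq_0_iff[OF c] assms(2) x by simp
  then show ?thesis using pos[OF x] by simp
qed

end

section \<open>The matrix form\<close>

abbreviation (input) star :: "complex poly \<Rightarrow> complex poly" where
  "star \<equiv> map_poly cnj"

lemma star_hom:
  "star (f + g) = star f + star g" "star (f - g) = star f - star g"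
  "star (f * g) = star f * star g" "star (pderiv f) = pderiv (star f)"
  "star (cst r) = cst r" "star X = X" "star (f ^ k) = star f ^ k"
  "star (smult c f) = smult (cnj c) (star f)" "star (numeral m) = numeral m"
proof -
  show *: "star (f * g) = star f * star g" for f g
    by (simp add: poly_eq_poly_eq_iff[symmetric] fun_eq_iff)
  show "star (f ^ k) = star f ^ k"
    by (simp add: poly_eq_poly_eq_iff[symmetric] fun_eq_iff)
qed (simp_all add: poly_eq_iff coeff_map_poly coeff_pderiv cst_def X_def coeff_pCons numeral_poly
    split: nat.split)

text \<open>The conjugate transpose at real arguments, kept polynomial: every entry of the matrix
  form becomes \<open>wint\<close> of a single polynomial.\<close>

definition mstar :: "mpol \<Rightarrow> mpol" where
  "mstar Q = transpose (map_matrix star Q)"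

lemma mstar_nth [simp]: "mstar Q $ i $ j = star (Q $ j $ i)"
  by (simp add: mstar_def transpose_def)

lemma mstar_add: "mstar (P + Q) = mstar P + mstar Q"
  by (simp add: vec_eq_iff star_hom)

lemma mstar_mconst: "mstar (mconst A ** Q) = mstar Q ** mconst (conj_transpose A)"
  by (simp add: vec_eq_iff matrix_matrix_mult_def sum_2 star_hom conj_transpose_def transpose_def
      map_poly_pCons)

definition wpol :: "real \<Rightarrow> real \<Rightarrow> mpol" where
  "wpol n p = mat2 (cst p * X\<^sup>2 + cst (n - p)) (- cst n * X) (- cst n * X) (cst (n - p) * X\<^sup>2 + cst p)"

lemma mform_integrand:
  "(meval P x ** weight n p x ** conj_transpose (meval Q x)) $ i $ j
    = (1 - x\<^sup>2) powr (n / 2 - 1) *\<^sub>R poly ((P ** wpol n p ** mstar Q) $ i $ j) (of_real x)"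
  by (simp add: matrix_matrix_mult_def sum_2 meval_def weight_def conj_transpose_def wpol_def
      transpose_def)
    (simp add: cst_def X_def scaleR_conv_of_real algebra_simps power2_eq_square)

lemma integrable_on_matrix:
  fixes F :: "real \<Rightarrow> cmat"
  assumes "\<And>i j. (\<lambda>x. F x $ i $ j) integrable_on S"
  shows "F integrable_on S"
proof (rule integrable_componentwise)
  fix b :: cmat
  assume "b \<in> Basis"
  then obtain i j u where "b = axis i (axis j u)" by (auto simp: Basis_vec_def)
  then show "(\<lambda>x. F x \<bullet> b) integrable_on S"
    using integrable_component[OF assms[of i j], of u] by (simp add: inner_axis)
qed

lemma mform_nth:
  assumes "n > 0"
  shows "mform (weight n p) P Q $ i $ j = wint n ((P ** wpol n p ** mstar Q) $ i $ j)"
proof -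
  have "(\<lambda>x. meval P x ** weight n p x ** conj_transpose (meval Q x)) integrable_on {-1..1}"
    using assms
    by (intro integrable_on_matrix) (simp add: mform_integrand powr_weight_poly_integrable)
  moreover have "bounded_linear (\<lambda>A::cmat. A $ i $ j)"
    by (intro bounded_linear_compose[OF bounded_linear_vec_nth bounded_linear_vec_nth])
  ultimately have "integral {-1..1} ((\<lambda>A. A $ i $ j) \<circ>
      (\<lambda>x. meval P x ** weight n p x ** conj_transpose (meval Q x))) = mform (weight n p) P Q $ i $ j"
    unfolding mform_def by (rule integral_linear)
  then show ?thesis by (simp add: o_def mform_integrand wint_def)
qed

context
  fixes n :: real
  assumes n: "n > 0"
begin

lemma mform_add_left: "mform (weight n p) (P + P') Q = mform (weight n p) P Q + mform (weight n p) P' Q"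
  by (simp add: vec_eq_iff mform_nth n wint_add matrix_add_rdistrib)

lemma mform_add_right: "mform (weight n p) P (Q + Q') = mform (weight n p) P Q + mform (weight n p) P Q'"
  by (simp add: vec_eq_iff mform_nth n wint_add mstar_add matrix_add_ldistrib)

lemma mform_mconst_left: "mform (weight n p) (mconst A ** P) Q = A ** mform (weight n p) P Q"
proof -
  have "wint n ((mconst A ** B) $ i $ j) = (\<Sum>k\<in>UNIV. A $ i $ k * wint n (B $ k $ j))" for B :: mpol and i j
    by (simp add: matrix_matrix_mult_def sum_2 wint_add[OF n] wint_smult[OF n])
  then show ?thesis
    by (simp add: vec_eq_iff mform_nth n matrix_mul_assoc[symmetric] matrix_matrix_mult_def[of A])
qed

lemma mform_mconst_right:
  "mform (weight n p) P (mconst A ** Q) = mform (weight n p) P Q ** conj_transpose A"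
proof -
  have "wint n ((B ** mconst A) $ i $ j) = (\<Sum>k\<in>UNIV. wint n (B $ i $ k) * A $ k $ j)"
    for B A :: "_^2^2" and i j
    by (simp add: matrix_matrix_mult_def sum_2 wint_add[OF n] wint_smult[OF n] mult.commute)
  then show ?thesis
    by (simp add: vec_eq_iff mform_nth n mstar_mconst matrix_mul_assoc
        matrix_matrix_mult_def[of _ "conj_transpose A"])
qed

end

text \<open>Integration by parts: the difference of the two integrands is the derivative of
  \<open>(1 - x^2) powr (n / 2) * \<Psi>\<close>, which vanishes at both ends. The last summand of \<open>\<Psi>\<close> makes up
  for the part of the first-order coefficient of \<open>\<Delta>\<close> that does not come from the weight.\<close>

lemma Dlt_symmetric:
  assumes n: "n > 0"
  shows "mform (weight n p) (Dlt n p P) Q = mform (weight n p) P (Dlt n p Q)"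
proof -
  have "wint n ((Dlt n p P ** wpol n p ** mstar Q) $ i $ j)
      = wint n ((P ** wpol n p ** mstar (Dlt n p Q)) $ i $ j)" for i j
  proof -
    define \<Psi> where "\<Psi> = (P ** wpol n p ** mstar (map_matrix pderiv Q)
      - map_matrix pderiv P ** wpol n p ** mstar Q
      - P ** mat2 0 (cst (n - 2 * p)) (- cst (n - 2 * p)) 0 ** mstar Q) $ i $ j"
    have "(Dlt n p P ** wpol n p ** mstar Q) $ i $ j - (P ** wpol n p ** mstar (Dlt n p Q)) $ i $ j
      = (1 - X\<^sup>2) * pderiv \<Psi> - cst n * X * \<Psi>"
      by (simp add: \<Psi>_def Dlt_def D1_nth D2_nth wpol_def matrix_matrix_mult_def sum_2 star_hom
          pderiv_add pderiv_diff pderiv_mult pderiv_minus cst_simps power2_eq_square)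
        (simp add: algebra_simps)
    then show ?thesis
      using wint_parts[OF n, of \<Psi>] wint_diff[OF n] by (metis eq_iff_diff_eq_0)
  qed
  then show ?thesis by (simp add: vec_eq_iff mform_nth n)
qed

text \<open>Monic polynomials of degrees below w generate everything of degree below w with constant
  left factors: each induction step removes the top coefficient.\<close>

lemma mform_monic_induct:
  assumes n: "n > 0" and Q: "\<And>v. mmonic v (Q v)"
    and orth: "\<And>v. v < w \<Longrightarrow> mform (weight n p) P (Q v) = 0"
    and R: "mdeg_lt R w"
  shows "mform (weight n p) P R = 0"
  using orth R
proof (induction w arbitrary: R)
  case 0
  then show ?case
    using mform_add_right[OF n, of p P 0 0] by simp
next
  case (Suc w)
  define R' where "R' = R - mconst (mcoeff R w) ** Q w"
  have "mdeg_lt R' w"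
    using Q[of w] Suc.prems(2) unfolding R'_def mmonic_iff
    by (intro mdeg_lt_Suc[of _ w] mdeg_lt_diff mdeg_lt_mconst) auto
  then have "mform (weight n p) P R' = 0"
    using Suc by simp
  moreover have "R = R' + mconst (mcoeff R w) ** Q w" by (simp add: R'_def)
  ultimately show ?case
    using Suc.prems(1)[OF lessI] by (metis add_0 times0_left mform_add_right[OF n] mform_mconst_right[OF n])
qed

section \<open>Definiteness of the form and identification of the orthogonal polynomials\<close>

context gegenbauer_weight
begin

lemma n_pos: "n > 0"
  using p_pos p_less by simp

lemma mform_definite:
  assumes "mform (weight n p) P P = 0"
  shows "P = 0"
proof -
  have "P $ i $ 1 = 0 \<and> P $ i $ 2 = 0" for i
  proof -
    define f g where "f = P $ i $ 1" and "g = P $ i $ 2"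
    define a b where "a = X * f - g" and "b = f - X * g"
    define h where "h = (P ** wpol n p ** mstar P) $ i $ i"
    \<comment> \<open>The weight matrix is a sum of two rank-one squares with positive coefficients
      p and n - p. Both squares vanish only if g = x f and f = x g, which forces f = g = 0.\<close>
    have h: "h = cst p * (a * star a) + cst (n - p) * (b * star b)"
      by (simp add: h_def a_def b_def f_def g_def wpol_def matrix_matrix_mult_def sum_2 star_hom
          cst_simps power2_eq_square algebra_simps)
    have Re_h: "Re (poly h (of_real x)) = p * (cmod (poly a (of_real x)))\<^sup>2
        + (n - p) * (cmod (poly b (of_real x)))\<^sup>2" for x
      by (simp add: h cst_def complex_mult_cnj cmod_power2)
    have "wint n h = 0"
      using assms mform_nth[OF n_pos, of p P P i i] by (simp add: h_def)
    then have "Re (poly h (of_real x)) = 0" if "x \<in> {-1/2..1/2}" for x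
      using that p_pos p_less by (intro wint_eq_0[OF n_pos]) (simp_all add: Re_h)
    then have "poly a (of_real x) = 0 \<and> poly b (of_real x) = 0" if "x \<in> {-1/2..1/2}" for x
      using that p_pos p_less
      by (fastforce simp: Re_h add_nonneg_eq_0_iff)
    then have "a = 0" "b = 0"
      using poly_eq_0_if_real_interval[of "-1/2" "1/2"] by auto
    then have g: "g = X * f" and f: "f = X * g" by (simp_all add: a_def b_def)
    then have "(1 - X\<^sup>2) * f = 0"
      by (metis cancel_comm_monoid_add_class.diff_cancel left_diff_distrib mult.assoc mult_1 power2_eq_square)
    moreover have "1 - X\<^sup>2 \<noteq> 0"
      by (simp add: X_def power2_eq_square one_pCons)
    ultimately show ?thesis using g by (simp add: f_def g_def)
  qed
  then show ?thesis by (simp add: vec_eq_iff forall_2)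
qed

text \<open>Symmetry of \<open>Dlt\<close> equates the two scalings of entry (i, j) of the form, by
  eigenvalues of degrees w and v. These differ for w \<noteq> v, so the entry is zero.\<close>

lemma monic_orthogonal_Qe: "monic_orthogonal (weight n p) Qe"
  unfolding monic_orthogonal_def
proof (intro conjI allI impI)
  fix w v :: nat
  assume "w \<noteq> v"
  let ?F = "mform (weight n p) (Qe w) (Qe v)"
  have "dmat (\<lambda>i. of_real (mu n p i w)) ** ?F =
      ?F ** conj_transpose (dmat (\<lambda>i. of_real (mu n p i v)))"
    using Dlt_symmetric[OF n_pos, of p "Qe w" "Qe v"]
    by (simp add: Dlt_Qe mform_mconst_left mform_mconst_right n_pos)
  moreover have "conj_transpose (dmat (\<lambda>i. complex_of_real (mu n p i v)))
      = dmat (\<lambda>i. of_real (mu n p i v))"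
    by (simp add: conj_transpose_def transpose_def dmat_def vec_eq_iff)
  ultimately have *: "of_real (mu n p i w) * ?F $ i $ j = ?F $ i $ j * of_real (mu n p j v)" for i j
    by (metis dmat_mult_nth mult_dmat_nth)
  have "mu n p i w \<noteq> mu n p j v" for i j
    using \<open>w \<noteq> v\<close> mu_neq by (metis linorder_neqE_nat)
  then have "?F $ i $ j = 0" for i j
    using *[of i j] by (metis mult.commute mult_right_cancel of_real_eq_iff)
  then show "?F = 0" by (simp add: vec_eq_iff)
qed (rule Qe)

text \<open>Uniqueness, which gives \<open>THE\<close> its meaning: the difference R of two
  candidates of degree w has degree below w, so both are orthogonal to it; then (R, R) = 0 and
  definiteness applies.\<close>

lemma orthopol_eq: "orthopol (weight n p) = Qe"
  unfolding orthopol_def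
proof (rule the_equality)
  show "monic_orthogonal (weight n p) Qe" by (rule monic_orthogonal_Qe)
next
  fix Q
  assume Q: "monic_orthogonal (weight n p) Q"
  show "Q = Qe"
  proof
    fix w
    define R where "R = Q w - Qe w"
    have "mdeg_lt R (Suc w)" "mcoeff R w = 0"
      using Q Qe[of w] by (auto simp: R_def mmonic_iff monic_orthogonal_def intro: mdeg_lt_diff)
    then have R: "mdeg_lt R w" by (rule mdeg_lt_Suc)
    have "mform (weight n p) (Q w) R = 0"
      using Q by (intro mform_monic_induct[OF n_pos _ _ R, of Q]) (auto simp: monic_orthogonal_def)
    moreover have "mform (weight n p) (Qe w) R = 0"
      using monic_orthogonal_Qe
      by (intro mform_monic_induct[OF n_pos _ _ R, of Qe]) (auto simp: monic_orthogonal_def)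
    moreover have "Q w = R + Qe w" by (simp add: R_def)
    ultimately have "mform (weight n p) R R = 0"
      using mform_add_left[OF n_pos, of p R "Qe w" R] by simp
    then show "Q w = Qe w"
      using mform_definite[of R] by (simp add: R_def)
  qed
qed

end

section \<open>Leading coefficients of operators\<close>

lemma matrix_sum_right: "(\<Sum>i\<in>S. f i) ** A = (\<Sum>i\<in>S. f i ** A)"
  for A :: "'a::semiring_1^'n^'m"
  by (induction S rule: infinite_finite_induct) (simp_all add: matrix_add_rdistrib)

abbreviation dm :: "mpol \<Rightarrow> mpol" where
  "dm \<equiv> map_matrix pderiv"

lemma dm_simps: "dm (P + Q) = dm P + dm Q" "dm 0 = 0" "dm (P ** Q) = dm P ** Q + P ** dm Q"
  by (simp_all add: vec_eq_iff pderiv_add matrix_matrix_mult_def sum_2 pderiv_mult algebra_simps)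

lemma dm_sum: "dm (\<Sum>i\<in>S. f i) = (\<Sum>i\<in>S. dm (f i))"
  by (induction S rule: infinite_finite_induct) (simp_all add: dm_simps)

text \<open>The coefficient \<open>L\<close> of \<open>\<partial>^s\<close> may be zero; \<open>K\<close> is the coefficient of
  \<open>\<partial>^(s-1)\<close>.\<close>

definition has_symbol :: "nat \<Rightarrow> mop \<Rightarrow> mpol \<Rightarrow> mpol \<Rightarrow> bool" where
  "has_symbol s D L K \<longleftrightarrow> (\<exists>F. D = diffop s F \<and> L = F s \<and> K = (if s = 0 then 0 else F (s - 1)))"

lemma has_symbol_diffop: "has_symbol s (diffop s F) (F s) (if s = 0 then 0 else F (s - 1))"
  by (auto simp: has_symbol_def)

lemma has_symbol_unique:
  assumes "has_symbol s D L K" "has_symbol s D L' K'"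
  shows "L = L'" "K = K'"
  using assms diffop_coeffs_unique[of s _ _ s] diffop_coeffs_unique[of s _ _ "s - 1"]
  unfolding has_symbol_def by fastforce+

lemma has_symbol_add:
  assumes "has_symbol s D L K" "has_symbol s E L' K'"
  shows "has_symbol s (\<lambda>P. D P + E P) (L + L') (K + K')"
proof -
  have "(\<lambda>P. diffop s F P + diffop s G P) = diffop s (\<lambda>i. F i + G i)" for F G
    by (simp add: fun_eq_iff diffop_def matrix_add_ldistrib sum.distrib)
  then show ?thesis
    using assms unfolding has_symbol_def by force
qed

lemma has_symbol_mult_right:
  assumes "has_symbol s D L K"
  shows "has_symbol s (\<lambda>P. D P ** G) (L ** G) (K ** G)"
proof -
  have "(\<lambda>P. diffop s F P ** G) = diffop s (\<lambda>i. F i ** G)" for F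
    by (simp add: fun_eq_iff diffop_def matrix_sum_right matrix_mul_assoc)
  then show ?thesis
    using assms unfolding has_symbol_def by force
qed

lemma has_symbol_pad:
  assumes "has_symbol s D L K"
  shows "has_symbol (Suc s) D 0 L"
proof -
  have "diffop s F = diffop (Suc s) (\<lambda>i. if i \<le> s then F i else 0)" for F
    by (simp add: fun_eq_iff diffop_def)
  then show ?thesis
    using assms unfolding has_symbol_def by force
qed

lemma has_symbol_pderiv:
  assumes "has_symbol s D L K"
  shows "has_symbol (Suc s) (\<lambda>P. dm (D P)) L (dm L + K)"
proof -
  have "dm (diffop s F P) = diffop (Suc s)
      (\<lambda>i. (if i \<le> s then dm (F i) else 0) + (if i = 0 then 0 else F (i - 1))) P" for F P
  proof -
    have "dm (diffop s F P) = (\<Sum>i\<le>s. (dm ^^ i) P ** dm (F i)) + (\<Sum>i\<le>s. (dm ^^ Suc i) P ** F i)"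
      by (simp add: diffop_def dm_sum dm_simps sum.distrib add.commute)
    also have "(\<Sum>i\<le>s. (dm ^^ i) P ** dm (F i))
        = (\<Sum>i\<le>Suc s. (dm ^^ i) P ** (if i \<le> s then dm (F i) else 0))"
      by simp
    also have "(\<Sum>i\<le>s. (dm ^^ Suc i) P ** F i)
        = (\<Sum>i\<le>Suc s. (dm ^^ i) P ** (if i = 0 then 0 else F (i - 1)))"
      by (subst sum.atMost_Suc_shift) simp
    finally show ?thesis
      by (simp only: diffop_def matrix_add_ldistrib sum.distrib)
  qed
  moreover obtain F where "D = diffop s F" "L = F s" "K = (if s = 0 then 0 else F (s - 1))"
    using assms by (auto simp: has_symbol_def)
  ultimately show ?thesis
    unfolding has_symbol_def
    by (intro exI[of _ "\<lambda>i. (if i \<le> s then dm (F i) else 0) + (if i = 0 then 0 else F (i - 1))"])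
      (auto simp: fun_eq_iff)
qed

lemma has_symbol_pderiv_iterate:
  assumes "has_symbol s D L K"
  shows "has_symbol (s + j) (\<lambda>P. (dm ^^ j) (D P)) L (mat (of_nat j) ** dm L + K)"
proof (induction j)
  case 0
  then show ?case using assms by (simp add: mat_0)
next
  case (Suc j)
  have "dm L + (mat (of_nat j) ** dm L + K) = mat (of_nat (Suc j)) ** dm L + K"
    by (simp add: vec_eq_iff mat_mult_nth algebra_simps)
  then show ?case
    using has_symbol_pderiv[OF Suc.IH] by (simp only: add_Suc_right funpow.simps o_apply)
qed

text \<open>Leibniz rule: in the two highest orders at most one derivative reaches the coefficients
  of the first factor, and it can hit L in t ways.\<close>

lemma has_symbol_comp:
  assumes "has_symbol s D L K" "has_symbol t E L' K'"
  shows "has_symbol (s + t) (\<lambda>P. E (D P)) (L ** L') (L ** K' + (mat (of_nat t) ** dm L + K) ** L')"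
proof -
  obtain G where G: "E = diffop t G" "L' = G t" "K' = (if t = 0 then 0 else G (t - 1))"
    using assms(2) by (auto simp: has_symbol_def)
  have "has_symbol (s + t) (\<lambda>P. diffop t G (D P)) (L ** G t)
      (L ** (if t = 0 then 0 else G (t - 1)) + (mat (of_nat t) ** dm L + K) ** G t)"
  proof (induction t)
    case 0
    have "diffop 0 G (D P) = D P ** G 0" for P by (simp add: diffop_def)
    then show ?case
      using has_symbol_mult_right[OF assms(1), of "G 0"] by (simp add: mat_0)
  next
    case (Suc t)
    have "diffop (Suc t) G (D P) = diffop t G (D P) + (dm ^^ Suc t) (D P) ** G (Suc t)" for P
      by (simp add: diffop_def)
    then show ?case
      using has_symbol_add[OF has_symbol_pad[OF Suc.IH]
          has_symbol_mult_right[OF has_symbol_pderiv_iterate[OF assms(1), of "Suc t", unfolded add_Suc_right]],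
          of "G (Suc t)"]
      by simp
  qed
  then show ?thesis using G by simp
qed

lemma diffop_extend: "s \<le> t \<Longrightarrow> diffop s F = diffop t (\<lambda>i. if i \<le> s then F i else 0)"
  by (rule ext, unfold diffop_def, rule sum.mono_neutral_cong_left) auto

lemma map_matrix_smult:
  "map_matrix (smult c) P = P ** mat [:c:]" "map_matrix (smult c) P = mconst (mat c) ** P"
  for P :: mpol
  by (auto simp: vec_eq_iff forall_2 matrix_matrix_mult_def sum_2 mat_def)

section \<open>The scalar differential equation and the factorisation of the leading
  coefficients\<close>

definition q :: "complex poly" where
  "q = X\<^sup>2 - 1"

lemma q_nz: "q \<noteq> 0" and degree_q: "degree q = 2" and lead_coeff_q: "coeff q 2 = 1"
proof -
  have q: "q = [:-1, 0, 1:]"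
    by (simp add: q_def X_def power2_eq_square one_pCons)
  show "q \<noteq> 0" "degree q = 2" "coeff q 2 = 1"
    unfolding q by (simp_all add: numeral_2_eq_2)
qed

lemma lead_coeff_pderiv: "lead_coeff (pderiv g) = of_nat (degree g) * lead_coeff g"
  for g :: "complex poly"
  by (cases "degree g") (auto simp: degree_pderiv coeff_pderiv pderiv_eq_0_iff coeff_eq_0)

lemma lead_coeff_X: "lead_coeff X = 1"
  by (simp add: X_def)

text \<open>Leading coefficients give degree k. For k > 0, evaluation at 1 and -1 shows that q
  divides g, so k \<ge> 2, and the quotient solves the equation for k - 2. The descent ends at a
  constant.\<close>

lemma q_ode:
  assumes "q * pderiv g = of_nat k * X * g" "g \<noteq> 0"
  shows "even k \<and> (\<exists>c. g = smult c (q ^ (k div 2)))"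
  using assms
proof (induction k arbitrary: g rule: less_induct)
  case (less k)
  have *: "coeff (of_nat k :: complex poly) 0 = of_nat k" by (simp add: of_nat_poly)
  have "lead_coeff (q * pderiv g) = lead_coeff (of_nat k * X * g)"
    using less.prems by simp
  then have deg: "degree g = k"
    using less.prems(2)
    by (simp add: lead_coeff_mult lead_coeff_pderiv lead_coeff_q degree_q lead_coeff_X *)
  show ?case
  proof (cases "k = 0")
    case True
    then obtain c where "g = [:c:]" using deg by (metis degree_eq_zeroE)
    then show ?thesis using True by simp
  next
    case False
    have "poly (q * pderiv g) x = poly (of_nat k * X * g) x" for x
      using less.prems by simp
    from this[of 1] this[of "-1"] have "poly g 1 = 0" "poly g (-1) = 0"
      using False by (simp_all add: q_def X_def)
    then have "[:-1, 1:] dvd g" and m1: "poly g (-1) = 0"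
      by (simp_all add: poly_eq_0_iff_dvd)
    then obtain h where h: "g = [:-1, 1:] * h" by (elim dvdE)
    with m1 have "[:- (-1), 1:] dvd h" by (subst poly_eq_0_iff_dvd[symmetric]) simp
    then obtain z where "h = [:- (-1), 1:] * z" by (elim dvdE)
    with h have g: "g = q * z"
      by (simp add: q_def X_def power2_eq_square one_pCons algebra_simps)
    have z: "z \<noteq> 0" using g less.prems(2) by auto
    have k: "k \<ge> 2" using deg z by (simp add: g degree_mult_eq q_nz degree_q)
    have "q * (q * pderiv z) = q * (of_nat (k - 2) * X * z)"
      using less.prems(1) k
      by (simp add: g pderiv_mult q_def pderiv_diff power2_eq_square of_nat_diff algebra_simps)
    then have "q * pderiv z = of_nat (k - 2) * X * z"
      using q_nz by (metis mult_left_cancel)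
    from less.IH[OF _ this z] obtain c where c: "even (k - 2)" "z = smult c (q ^ ((k - 2) div 2))"
      using k by auto
    obtain m where "k = Suc (Suc m)" using k by (metis add_2_eq_Suc le_Suc_ex)
    with c g show ?thesis by (auto simp: mult.commute)
  qed
qed

lemma coeff_mult_add:
  fixes f g :: "'a::comm_semiring_0 poly"
  assumes "degree f \<le> m" "degree g \<le> k"
  shows "coeff (f * g) (m + k) = coeff f m * coeff g k"
proof (cases "degree f = m \<and> degree g = k")
  case True
  then show ?thesis using coeff_mult_degree_sum[of f g] by auto
next
  case False
  then have "degree f < m \<or> degree g < k" using assms by linarith
  moreover have "degree (f * g) < m + k"
    using False assms degree_mult_le[of f g] by linarith
  ultimately show ?thesis by (auto simp: coeff_eq_0)
qed

text \<open>The leading coefficients of D1, D4, D3, D2 are \<open>Sm ** E ** Tm\<close> with E the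
  matrix unit at (1,1), (1,2), (2,1), (2,2) respectively.\<close>

definition Tm :: mpol where "Tm = mat2 X 1 1 X"
definition Sm :: mpol where "Sm = mat2 X (-1) (-1) X"

lemma Sm_Tm: "Sm ** Tm = mat q"
  by (simp add: Sm_def Tm_def vec_eq_iff forall_2 matrix_matrix_mult_def sum_2 mat_def q_def
      power2_eq_square)

lemma mat_commute: "mat f ** P = P ** mat f" for P :: "'a::comm_semiring_1^2^2"
  by (simp add: vec_eq_iff forall_2 matrix_matrix_mult_def sum_2 mat_def mult.commute)

lemma mat_mult_mat: "mat f ** mat g = (mat (f * g) :: 'a::semiring_1^2^2)"
  by (simp add: vec_eq_iff mat_mult_nth) (simp add: mat_def)

lemma mat_mult_cancel: "f \<noteq> 0 \<Longrightarrow> mat f ** P = mat f ** Q \<longleftrightarrow> P = Q"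
  for P :: "'a::idom^2^2"
  by (simp add: vec_eq_iff mat_mult_nth)

definition has_top :: "nat \<Rightarrow> mop \<Rightarrow> mpol \<Rightarrow> bool" where
  "has_top s D L \<longleftrightarrow> (\<exists>K. has_symbol s D L K)"

lemma has_top_comp: "has_top s D L \<Longrightarrow> has_top t E L' \<Longrightarrow> has_top (s + t) (\<lambda>P. E (D P)) (L ** L')"
  and has_top_add: "has_top s D L \<Longrightarrow> has_top s E L' \<Longrightarrow> has_top s (\<lambda>P. D P + E P) (L + L')"
  and has_top_mult_right: "has_top s D L \<Longrightarrow> has_top s (\<lambda>P. D P ** G) (L ** G)"
  and has_top_diffop: "has_top s (diffop s F) (F s)"
  unfolding has_top_def
  by (blast intro: has_symbol_comp has_symbol_add has_symbol_mult_right has_symbol_diffop)+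

lemma has_top_ex: "has_top s D L \<Longrightarrow> \<exists>F. D = diffop s F \<and> F s = L"
  by (auto simp: has_top_def has_symbol_def)

lemma has_symbol_diffop2:
  assumes "map_matrix (map_poly of_real) F2 = L" "map_matrix (map_poly of_real) F1 = K"
  shows "has_symbol 2 (diffop2 F2 F1 F0) L K"
  using has_symbol_diffop[of 2 "\<lambda>i. map_matrix (map_poly complex_of_real) ([F0, F1, F2] ! i)"] assms
  by (simp add: diffop2_def)

lemma has_top_diffop2:
  "map_matrix (map_poly of_real) F2 = L \<Longrightarrow> has_top 2 (diffop2 F2 F1 F0) L"
  by (auto simp: has_top_def intro: has_symbol_diffop2)

lemmas poly_entry_simps =
  vec_eq_iff forall_2 map_poly_pCons X_def cst_def power2_eq_square one_pCons

lemma has_top_D: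
  "has_top 2 (D1 n p) (mat2 (X\<^sup>2) X (- X) (- 1))"
  "has_top 2 (D2 n p) (mat2 (- 1) (- X) X (X\<^sup>2))"
  "has_top 2 (D3 n p) (mat2 (- X) (- 1) (X\<^sup>2) X)"
  "has_top 2 (D4 n p) (mat2 X (X\<^sup>2) (- 1) (- X))"
  unfolding D1_def D2_def D3_def D4_def
  by (rule has_top_diffop2, simp add: poly_entry_simps)+

lemma has_symbol_Dlt:
  "has_symbol 2 (Dlt n p) (mat q) (mat2 (cst (n + 2) * X) 2 2 (cst (n + 2) * X))"
proof -
  have "has_symbol 2 (\<lambda>P. D1 n p P + D2 n p P)
     (mat2 (X\<^sup>2) X (- X) (- 1) + mat2 (- 1) (- X) X (X\<^sup>2))
     (mat2 (cst (n + 2) * X) (cst (n - p + 2)) (cst (- p)) 0 +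
      mat2 0 (cst (p - n)) (cst (p + 2)) (cst (n + 2) * X))"
    unfolding D1_def D2_def
    by (intro has_symbol_add has_symbol_diffop2) (simp_all add: poly_entry_simps)
  moreover have "(\<lambda>P. D1 n p P + D2 n p P) = Dlt n p" by (simp add: fun_eq_iff Dlt_def)
  moreover have "mat2 (X\<^sup>2) X (- X) (- 1) + mat2 (- 1) (- X) X (X\<^sup>2) = mat q"
    by (simp add: vec_eq_iff forall_2 mat_def q_def)
  moreover have "mat2 (cst (n + 2) * X) (cst (n - p + 2)) (cst (- p)) 0 +
      mat2 0 (cst (p - n)) (cst (p + 2)) (cst (n + 2) * X)
      = mat2 (cst (n + 2) * X) 2 2 (cst (n + 2) * X)"
    by (simp add: vec_eq_iff forall_2 cst_simps)
  ultimately show ?thesis by simp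
qed

text \<open>Comparing the coefficients of \<open>\<partial>^(m+1)\<close> in \<open>G \<Delta> = \<Delta> G\<close>.\<close>

lemma commute_Dlt_symbol:
  assumes G: "has_top m G L" and comm: "\<And>P. Dlt n p (G P) = G (Dlt n p P)"
  defines "B \<equiv> mat2 0 1 1 0"
  shows "mat q ** dm L + L ** B = mat (of_nat m * X) ** L + B ** L"
proof -
  define B' where "B' = mat2 (cst (n + 2) * X) 2 2 (cst (n + 2) * X)"
  obtain K where K: "has_symbol m G L K" using G by (auto simp: has_top_def)
  have "has_symbol (m + 2) (\<lambda>P. Dlt n p (G P)) (L ** mat q)
      (L ** B' + (mat (of_nat 2) ** dm L + K) ** mat q)"
    unfolding B'_def by (rule has_symbol_comp[OF K has_symbol_Dlt])
  moreover have "has_symbol (2 + m) (\<lambda>P. G (Dlt n p P)) (mat q ** L)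
      (mat q ** K + (mat (of_nat m) ** dm (mat q) + B') ** L)"
    unfolding B'_def by (rule has_symbol_comp[OF has_symbol_Dlt K])
  ultimately have "L ** B' + (mat 2 ** dm L + K) ** mat q
      = mat q ** K + (mat (of_nat m) ** dm (mat q) + B') ** L"
    using has_symbol_unique(2)[of "m + 2"] by (simp add: comm add.commute)
  moreover have "dm (mat q) = mat (2 * X)"
    by (simp add: vec_eq_iff mat_def q_def pderiv_diff power2_eq_square pderiv_mult)
  \<comment> \<open>The terms with K cancel because \<open>mat q\<close> is central, and so does the
    scalar part of \<open>B'\<close>. Only twice the exchange matrix B survives.\<close>
  moreover have "B' = mat (cst (n + 2) * X) + mat 2 ** B"
    by (simp add: vec_eq_iff forall_2 mat_mult_nth B'_def B_def) (simp add: mat_def)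
  ultimately have "mat 2 ** (mat q ** dm L + L ** B) = mat 2 ** (mat (of_nat m * X) ** L + B ** L)"
    by (simp add: vec_eq_iff forall_2 matrix_matrix_mult_def sum_2 mat_def algebra_simps)
  then show ?thesis by (simp add: mat_mult_cancel)
qed

section \<open>Leading coefficients of eigenoperators\<close>

context gegenbauer_weight
begin

abbreviation DW :: "mop set" where
  "DW \<equiv> diff_algebra (weight n p)"

lemma DW_iff: "D \<in> DW \<longleftrightarrow> (\<exists>s F. D = diffop s F) \<and> (\<forall>w. \<exists>\<Lambda>. D (Qe w) = mconst \<Lambda> ** Qe w)"
  by (simp add: diff_algebra_def orthopol_eq)

lemma DW_linear:
  assumes "D \<in> DW"
  shows "D (P + Q) = D P + D Q" "D (mconst A ** P) = mconst A ** D P"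
  using assms by (auto simp: DW_iff diffop_add diffop_mconst)

text \<open>The polynomials \<open>Qe w\<close> span M_2[x] with constant left factors, so maps
  compatible with such factors are determined by their values there.\<close>

lemma linear_eqI:
  assumes D: "\<And>P Q. D (P + Q) = D P + D Q" "\<And>A P. D (mconst A ** P) = mconst A ** D P"
    and E: "\<And>P Q. E (P + Q) = E P + E Q" "\<And>A P. E (mconst A ** P) = mconst A ** E P"
    and eq: "\<And>w. D (Qe w) = (E (Qe w) :: mpol)"
  shows "D P = E P"
proof -
  obtain w where "mdeg_lt P w" using mdeg_lt_exists by blast
  then show ?thesis
  proof (induction w arbitrary: P)
    case 0
    then show ?case using D(2)[of 0 0] E(2)[of 0 0] by simp
  next
    case (Suc w)
    define P' where "P' = P - mconst (mcoeff P w) ** Qe w"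
    have "mdeg_lt P' w"
      unfolding P'_def
      by (rule mdeg_lt_Suc) (simp_all add: mdeg_lt_diff mdeg_lt_mconst Suc.prems Qe_deg Qe_lead)
    then have "D P' = E P'" by (rule Suc.IH)
    moreover have "P = P' + mconst (mcoeff P w) ** Qe w" by (simp add: P'_def)
    ultimately show ?case by (metis D E eq)
  qed
qed

lemma D_in_DW: "D1 n p \<in> DW" "D2 n p \<in> DW" "D3 n p \<in> DW" "D4 n p \<in> DW"
  unfolding DW_iff using D1_Qe D2_Qe D3_Qe D4_Qe
  by (auto simp: D1_def D2_def D3_def D4_def diffop2_def)

lemma DW_one: "(\<lambda>P. P) \<in> DW"
proof -
  have "(\<lambda>P. P) = diffop 0 (\<lambda>_. mat 1)" by (simp add: fun_eq_iff diffop_def)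
  moreover have "Qe w = mconst (mat 1) ** Qe w" for w by simp
  ultimately show ?thesis unfolding DW_iff by blast
qed

lemma DW_add:
  assumes "D \<in> DW" "E \<in> DW"
  shows "(\<lambda>P. D P + E P) \<in> DW"
proof -
  obtain s F t G where "D = diffop s F" "E = diffop t G"
    using assms by (auto simp: DW_iff)
  then obtain F' G' where "D = diffop (max s t) F'" "E = diffop (max s t) G'"
    using diffop_extend[OF max.cobounded1[of s t]] diffop_extend[OF max.cobounded2[of t s]] by blast
  then have "\<exists>s F. (\<lambda>P. D P + E P) = diffop s F"
    using has_top_ex[OF has_top_add[OF has_top_diffop[of "max s t" F'] has_top_diffop[of _ G']]] by auto
  moreover have "\<exists>\<Lambda>. D (Qe w) + E (Qe w) = mconst \<Lambda> ** Qe w" for w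
    using assms unfolding DW_iff by (metis matrix_add_rdistrib mconst_add)
  ultimately show ?thesis by (simp add: DW_iff)
qed

lemma DW_scale:
  assumes "D \<in> DW"
  shows "(\<lambda>P. map_matrix (smult c) (D P)) \<in> DW"
proof -
  obtain s F where "D = diffop s F"
    using assms by (auto simp: DW_iff)
  then have "\<exists>s F. (\<lambda>P. map_matrix (smult c) (D P)) = diffop s F"
    using has_top_ex[OF has_top_mult_right[OF has_top_diffop[of s F], of "mat [:c:]"]]
    by (auto simp: map_matrix_smult(1))
  moreover have "\<exists>\<Lambda>. map_matrix (smult c) (D (Qe w)) = mconst \<Lambda> ** Qe w" for w
    using assms unfolding DW_iff map_matrix_smult(2) by (metis matrix_mul_assoc mconst_mult)
  ultimately show ?thesis by (simp add: DW_iff)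
qed

lemma DW_comp:
  assumes "D \<in> DW" "E \<in> DW"
  shows "(\<lambda>P. E (D P)) \<in> DW"
proof -
  obtain s F t G where "D = diffop s F" "E = diffop t G"
    using assms by (auto simp: DW_iff)
  then have "\<exists>s F. (\<lambda>P. E (D P)) = diffop s F"
    using has_top_ex[OF has_top_comp[OF has_top_diffop[of s F] has_top_diffop[of t G]]] by auto
  moreover have "\<exists>\<Lambda>. E (D (Qe w)) = mconst \<Lambda> ** Qe w" for w
    using assms DW_linear(2)[OF assms(2)] unfolding DW_iff by (metis matrix_mul_assoc mconst_mult)
  ultimately show ?thesis by (simp add: DW_iff)
qed

abbreviation gens :: "mop set" where
  "gens \<equiv> {D1 n p, D2 n p, D3 n p, D4 n p}"

lemma gen_subset_DW: "D \<in> gen_algebra gens \<Longrightarrow> D \<in> DW"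
proof (induction rule: gen_algebra.induct)
  case (gen D)
  then show ?case using D_in_DW by blast
next
  case one
  show ?case by (rule DW_one)
next
  case (add D E)
  show ?case by (rule DW_add[OF add.IH])
next
  case (scale D c)
  show ?case by (rule DW_scale[OF scale.IH])
next
  case (mult D E)
  show ?case by (rule DW_comp[OF mult.IH])
qed

lemma mat_left_commute: "A ** (mat f ** B) = mat f ** (A ** B)" for A B :: "'a::comm_semiring_1^2^2"
  by (simp add: vec_eq_iff forall_2 matrix_matrix_mult_def sum_2 mat_def algebra_simps)

text \<open>Multiplying \<open>D\<close> on both sides by generators moves any entry of its eigenvalue to the
  top left corner; the product then commutes with \<open>\<Delta>\<close>, whose eigenvalue is diagonal.\<close>

lemma top_entry_ode:
  assumes D: "D \<in> DW" and F: "has_top s D F"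
  shows "q * pderiv ((Tm ** F ** Sm) $ i $ j) = of_nat (s + 2) * X * (Tm ** F ** Sm) $ i $ j"
proof -
  define g where "g = (Tm ** F ** Sm) $ i $ j"
  define L where "L = (if i = 1 then D1 n p else D4 n p)"
  define L' where "L' = (if i = 1 then mat2 (X\<^sup>2) X (- X) (- 1) else mat2 X (X\<^sup>2) (- 1) (- X))"
  define R where "R = (if j = 1 then D1 n p else D3 n p)"
  define R' where "R' = (if j = 1 then mat2 (X\<^sup>2) X (- X) (- 1) else mat2 (- X) (- 1) (X\<^sup>2) X)"
  define G where "G = (\<lambda>P. R (D (L P)))"
  define M where "M = mat2 (X\<^sup>2) X (- X) (- 1)"
  have L: "has_top 2 L L'" and R: "has_top 2 R R'"
    by (auto simp: L_def L'_def R_def R'_def has_top_D)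
  have "i = 1 \<or> i = 2" "j = 1 \<or> j = 2" using exhaust_2 by blast+
  \<comment> \<open>With matrix units, \<open>L'\<close> is Sm E_1i Tm and \<open>R'\<close> is Sm
    E_j1 Tm. The product therefore isolates entry (i, j) of Tm F Sm and leaves the leading
    coefficient Sm E_11 Tm of D1.\<close>
  then have "L' ** F ** R' = mat g ** mat2 (X\<^sup>2) X (- X) (- 1)"
    by (elim disjE; simp add: L'_def R'_def g_def Tm_def Sm_def vec_eq_iff forall_2
        mat_def matrix_matrix_mult_def sum_2 power2_eq_square algebra_simps)
  then have top: "has_top (s + 4) G (mat g ** mat2 (X\<^sup>2) X (- X) (- 1))"
    using has_top_comp[OF has_top_comp[OF L F] R] by (simp add: G_def numeral_eq_Suc)
  have LR: "L \<in> DW" "R \<in> DW"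
    by (simp_all add: L_def R_def D_in_DW)
  have "G \<in> DW"
    unfolding G_def by (rule DW_comp[OF DW_comp[OF LR(1) D] LR(2)])
  note lin = DW_linear[OF this]
  have comm: "Dlt n p (G (Qe w)) = G (Dlt n p (Qe w))" for w
  proof -
    define l where "l = complex_of_real (if i = 1 then mu n p 1 w else (w + n - p) * (w + n - p + 1))"
    have l: "L (Qe w) = mconst (if i = 1 then mat2 l 0 0 0 else mat2 0 l 0 0) ** Qe w"
      by (cases "i = 1") (simp_all only: L_def l_def D1_Qe D4_Qe if_True if_False simp_thms)
    define r where "r = complex_of_real (if j = 1 then mu n p 1 w else (w + p) * (w + p + 1))"
    have r: "R (Qe w) = mconst (if j = 1 then mat2 r 0 0 0 else mat2 0 0 r 0) ** Qe w"
      by (cases "j = 1") (simp_all only: R_def r_def D1_Qe D3_Qe if_True if_False simp_thms)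
    obtain \<Lambda> where \<Lambda>: "D (Qe w) = mconst \<Lambda> ** Qe w" using D by (auto simp: DW_iff)
    have "G (Qe w) = mconst ((if i = 1 then mat2 l 0 0 0 else mat2 0 l 0 0) ** \<Lambda> **
        (if j = 1 then mat2 r 0 0 0 else mat2 0 0 r 0)) ** Qe w"
      by (simp only: G_def l \<Lambda> r DW_linear(2)[OF D] DW_linear(2)[OF LR(2)]
          mconst_mult[symmetric] matrix_mul_assoc)
    also have "(if i = 1 then mat2 l 0 0 0 else mat2 0 l 0 0) ** \<Lambda> **
        (if j = 1 then mat2 r 0 0 0 else mat2 0 0 r 0) = mat2 (l * \<Lambda> $ i $ j * r) 0 0 0"
      using exhaust_2[of i] exhaust_2[of j]
      by (auto simp: vec_eq_iff forall_2 matrix_matrix_mult_def sum_2)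
    finally have G: "G (Qe w) = mconst (mat2 (l * \<Lambda> $ i $ j * r) 0 0 0) ** Qe w" .
    have "mat2 (l * \<Lambda> $ i $ j * r) 0 0 0 ** dmat (\<lambda>i. of_real (mu n p i w))
        = dmat (\<lambda>i. of_real (mu n p i w)) ** mat2 (l * \<Lambda> $ i $ j * r) 0 0 0"
      by (simp add: vec_eq_iff forall_2)
    then show ?thesis
      by (simp only: G Dlt_mconst Dlt_Qe lin matrix_mul_assoc mconst_mult[symmetric])
  qed
  have "Dlt n p (G P) = G (Dlt n p P)" for P
    by (rule linear_eqI[of "\<lambda>P. Dlt n p (G P)" "\<lambda>P. G (Dlt n p P)"])
      (simp_all only: lin Dlt_add Dlt_mconst comm)
  from commute_Dlt_symbol[OF top this]
  \<comment> \<open>Entry (2, 2) is compared because M is the constant -1 there. The two products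
    with the exchange matrix contribute 2 x g together, which lowers s + 4 to s + 2.\<close>
  have "(mat q ** dm (mat g ** M) + (mat g ** M) ** mat2 0 1 1 0) $ 2 $ 2
      = (mat (of_nat (s + 4) * X) ** (mat g ** M) + mat2 0 1 1 0 ** (mat g ** M)) $ 2 $ 2"
    unfolding M_def by (rule arg_cong[where f = "\<lambda>N. N $ 2 $ 2"])
  then have "q * pderiv (- g) - g * X = of_nat (s + 4) * X * (- g) + g * X"
    by (simp only: vector_add_component mat_mult_nth nth_map_matrix)
      (simp add: M_def matrix_matrix_mult_def[of _ "mat2 _ _ _ _"]
        matrix_matrix_mult_def[of "mat2 _ _ _ _"] sum_2 mat_def power2_eq_square)
  then have "q * pderiv g = (of_nat (s + 4) - 2) * X * g"
    by (simp only: pderiv_minus) algebra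
  then show ?thesis
    by (simp add: g_def[symmetric])
qed

text \<open>Sm (Tm F Sm) Tm is q^2 F, so F is recovered from the entries of Tm F Sm. Each entry is a
  constant multiple of q^(s/2 + 1), and a nonzero one forces s to be even; one factor q
  cancels.\<close>

lemma top_coefficient:
  assumes "D \<in> DW" "has_top s D F" "F \<noteq> 0"
  shows "even s \<and> (\<exists>A. mat q ** F = mat (q ^ (s div 2)) ** Sm ** mconst A ** Tm)"
proof -
  let ?H = "Tm ** F ** Sm"
  have "Sm ** ?H ** Tm = (Sm ** Tm) ** F ** (Sm ** Tm)"
    by (simp only: matrix_mul_assoc)
  then have H: "Sm ** ?H ** Tm = mat q ** (mat q ** F)"
    by (simp only: Sm_Tm mat_commute[of q "mat q ** F"])
  note ode = q_ode[OF top_entry_ode[OF assms(1,2)]]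
  have "?H \<noteq> 0"
    using H assms(3) mat_mult_cancel[OF q_nz, of "mat q ** F" 0] mat_mult_cancel[OF q_nz, of F 0]
    by auto
  then obtain i j where "?H $ i $ j \<noteq> 0" by (auto simp: vec_eq_iff)
  then have s: "even s" using ode by auto
  have "\<exists>c. ?H $ i $ j = smult c (q * q ^ (s div 2))" for i j
    using ode[of i j] s by (cases "?H $ i $ j = 0") (auto intro: exI[of _ 0])
  then obtain A where A: "?H $ i $ j = smult (A i j) (q * q ^ (s div 2))" for i j
    by metis
  have "?H = mat q ** (mat (q ^ (s div 2)) ** mconst (\<chi> i j. A i j))"
    by (simp add: vec_eq_iff mat_mult_nth A)
  then have "mat q ** (mat q ** F) = mat q ** (mat (q ^ (s div 2)) ** Sm ** mconst (\<chi> i j. A i j) ** Tm)"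
    unfolding H[symmetric] by (simp only: matrix_mul_assoc[symmetric] mat_left_commute[of Sm])
  then show ?thesis
    using s q_nz by (auto simp: mat_mult_cancel)
qed

end

text \<open>Both \<open>Sm\<close> and \<open>Tm\<close> are x times the identity plus a constant,
  so A is the x^2 coefficient of their product around A. Since q is monic of degree 2, division by q
  keeps A as the top coefficient.\<close>

lemma top_degree:
  assumes "mat q ** F = mat (q ^ k) ** Sm ** mconst A ** Tm"
  shows "mdeg_lt F (Suc (2 * k)) \<and> mcoeff F (2 * k) = A"
proof -
  have dq: "degree (q ^ k) = 2 * k" and lq: "coeff (q ^ k) (2 * k) = 1" for k
    using lead_coeff_power[of q k]
    by (simp_all add: degree_power_eq q_nz degree_q lead_coeff_q mult.commute)
  define B where "B = Sm ** mconst A ** Tm"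
  have B: "degree (B $ i $ j) \<le> 2" "coeff (B $ i $ j) 2 = A $ i $ j" for i j
    using exhaust_2[of i] exhaust_2[of j]
    by (auto simp: B_def Sm_def Tm_def matrix_matrix_mult_def sum_2 X_def numeral_2_eq_2
        intro!: degree_add_le degree_diff_le degree_pCons_le[THEN order_trans])
  have e: "q * F $ i $ j = q ^ k * B $ i $ j" for i j
    using assms by (simp add: vec_eq_iff mat_mult_nth B_def matrix_mul_assoc[symmetric])
  have d: "degree (F $ i $ j) \<le> 2 * k" for i j
  proof (cases "F $ i $ j = 0")
    case False
    then have "2 + degree (F $ i $ j) = degree (q * F $ i $ j)"
      by (simp add: degree_mult_eq q_nz degree_q)
    also have "\<dots> \<le> 2 * k + 2"
      unfolding e using B(1) dq degree_mult_le by (metis add_left_mono order_trans)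
    finally show ?thesis by simp
  qed simp
  have "coeff (F $ i $ j) (2 * k) = A $ i $ j" for i j
    using coeff_mult_add[of q 2 "F $ i $ j" "2 * k"] coeff_mult_add[of "q ^ k" "2 * k" "B $ i $ j" 2]
      d B dq lq e[of i j] by (simp add: degree_q lead_coeff_q add.commute)
  then have "mcoeff F (2 * k) = A" by (simp add: vec_eq_iff)
  moreover have "mdeg_lt F (Suc (2 * k))"
    using d by (intro mdeg_ltI coeff_eq_0) (meson Suc_le_lessD le_less_trans)
  ultimately show ?thesis by blast
qed

section \<open>Generation\<close>

lemma has_top_smult:
  "has_top s D L \<Longrightarrow> has_top s (\<lambda>P. map_matrix (smult c) (D P)) (L ** mat [:c:])"
  unfolding map_matrix_smult(1) by (rule has_top_mult_right)

lemma has_top_one: "has_top 0 (\<lambda>P. P) (mat 1)"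
  using has_top_diffop[of 0 "\<lambda>_. mat 1"] by (simp add: diffop_def[abs_def])

lemma has_top_Dlt_power: "has_top (2 * j) (Dlt n p ^^ j) (mat (q ^ j))"
proof (induction j)
  case 0
  then show ?case using has_top_one by (simp add: id_def)
next
  case (Suc j)
  have "has_top 2 (Dlt n p) (mat q)" using has_symbol_Dlt by (auto simp: has_top_def)
  from has_top_comp[OF Suc.IH this] show ?case
    by (simp add: mat_mult_mat o_def mult.commute)
qed

context gegenbauer_weight
begin

lemma Dlt_power_in_gen: "(\<lambda>P. (Dlt n p ^^ j) P) \<in> gen_algebra gens"
proof (induction j)
  case 0
  show ?case using gen_algebra.one by simp
next
  case (Suc j)
  have "(\<lambda>P. D1 n p P + D2 n p P) \<in> gen_algebra gens"
    by (intro gen_algebra.add gen_algebra.gen) auto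
  then have "Dlt n p \<in> gen_algebra gens" by (simp add: Dlt_def[abs_def])
  from gen_algebra.mult[OF Suc.IH this] show ?case by simp
qed

text \<open>Powers of \<open>Dlt\<close> contribute the scalar q^j, and the four generators
  contribute the matrix units between \<open>Sm\<close> and \<open>Tm\<close>; the entries of A are
  the weights of the combination.\<close>

lemma gen_with_top:
  "\<exists>E\<in>gen_algebra gens. has_top (2 * Suc j) E (mat (q ^ j) ** Sm ** mconst A ** Tm)"
proof -
  define U where "U D c = (\<lambda>P. map_matrix (smult c) (D ((Dlt n p ^^ j) P)))" for D :: mop and c
  have U: "U D c \<in> gen_algebra gens" if "D \<in> gens" for D c
    unfolding U_def
    by (rule gen_algebra.scale[OF gen_algebra.mult[OF Dlt_power_in_gen gen_algebra.gen[OF that]]])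
  have top: "has_top (2 * Suc j) (U D c) (mat (q ^ j) ** L ** mat [:c:])" if "has_top 2 D L" for D L c
    using has_top_smult[OF has_top_comp[OF has_top_Dlt_power that]] by (simp add: U_def)
  let ?E = "\<lambda>P. (U (D1 n p) (A $ 1 $ 1) P + U (D4 n p) (A $ 1 $ 2) P)
    + (U (D3 n p) (A $ 2 $ 1) P + U (D2 n p) (A $ 2 $ 2) P)"
  have "?E \<in> gen_algebra gens"
    by (intro gen_algebra.add U) auto
  moreover have "has_top (2 * Suc j) ?E
      ((mat (q ^ j) ** mat2 (X\<^sup>2) X (- X) (- 1) ** mat [:A $ 1 $ 1:] +
        mat (q ^ j) ** mat2 X (X\<^sup>2) (- 1) (- X) ** mat [:A $ 1 $ 2:]) +
       (mat (q ^ j) ** mat2 (- X) (- 1) (X\<^sup>2) X ** mat [:A $ 2 $ 1:] +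
        mat (q ^ j) ** mat2 (- 1) (- X) X (X\<^sup>2) ** mat [:A $ 2 $ 2:]))" (is "has_top _ _ ?T")
    by (intro has_top_add top has_top_D)
  moreover have "?T = mat (q ^ j) ** (Sm ** mconst A ** Tm)"
    unfolding mat_commute[of "[:_:]", symmetric] mat_left_commute[of "mat [:_:]" "q ^ j"]
      matrix_add_ldistrib[symmetric]
    by (rule arg_cong[where f = "\<lambda>M. mat (q ^ j) ** M"])
      (simp add: vec_eq_iff forall_2 mat_mult_nth, simp add: Sm_def Tm_def matrix_matrix_mult_def sum_2
        power2_eq_square smult_add_right algebra_simps)
  ultimately show ?thesis by (auto simp: matrix_mul_assoc)
qed

text \<open>Both values come from constant terms in the eigenvalue equation for D1: entry (1, 2)
  directly, and entry (2, 1) from the vanishing of row 2.\<close>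

lemma Qe_1_nth:
  "mcoeff (Qe 1) 0 $ 1 $ 2 = of_real (1 / (p + 1))"
  "mcoeff (Qe 1) 0 $ 2 $ 1 = of_real (1 / (n - p + 1))"
proof -
  have 0: "coeff (Qe (Suc 0) $ i $ j) k = 0" if "k \<ge> 2" for i j k
    using that by (intro mdeg_lt_coeff[OF Qe_deg]) simp
  have 1: "coeff (Qe (Suc 0) $ i $ j) (Suc 0) = (if i = j then 1 else 0)" for i j
    using Qe_lead[of 1] by (simp add: vec_eq_iff mat_def)
  have e: "coeff (D1 n p (Qe 1) $ i $ j) 0
      = coeff ((mconst (mat2 (of_real (mu n p 1 1)) 0 0 0) ** Qe 1) $ i $ j) 0" for i j
    by (simp add: D1_Qe)
  have cancel: "c = of_real (1 / b)" if "of_real a = of_real (a * b) * c" "a \<noteq> 0" "b \<noteq> 0"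
    for a b and c :: complex
    using that by (simp add: field_simps)
  have "complex_of_real (n - p + 2) = of_real (mu n p 1 1) * coeff (Qe 1 $ 1 $ 2) 0"
    using e[of 1 2]
    by (simp add: D1_nth coeff_ops coeff_pderiv 0 1 matrix_matrix_mult_def sum_2 del: of_real_diff of_real_add)
  moreover have "mu n p 1 1 = (n - p + 2) * (p + 1)"
    by (simp add: mu_def algebra_simps)
  moreover have "n - p + 2 \<noteq> 0" "p + 1 \<noteq> 0" using p_pos p_less by auto
  ultimately show "mcoeff (Qe 1) 0 $ 1 $ 2 = of_real (1 / (p + 1))"
    unfolding mcoeff_nth by (intro cancel[of "n - p + 2"]) simp_all
  have "complex_of_real p = of_real (p * (n - p + 1)) * coeff (Qe 1 $ 2 $ 1) 0"
    using e[of 2 1]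
    by (simp add: D1_nth coeff_ops coeff_pderiv 0 1 matrix_matrix_mult_def sum_2 del: of_real_diff of_real_add)
  then show "mcoeff (Qe 1) 0 $ 2 $ 1 = of_real (1 / (n - p + 1))"
    unfolding mcoeff_nth using p_pos p_less by (intro cancel[of p]) simp_all
qed

lemma order_zero_scalar:
  assumes D: "diffop 0 F \<in> DW" and F: "F 0 \<noteq> 0"
  shows "\<exists>a. F 0 = mat [:a:]"
proof -
  obtain A where A: "mat q ** F 0 = mat (q ^ 0) ** Sm ** mconst A ** Tm"
    using top_coefficient[OF D has_top_diffop F] by auto
  then have "mdeg_lt (F 0) 1" "mcoeff (F 0) 0 = A"
    using top_degree[OF A] by auto
  then have FA: "F 0 = mconst A"
    by (intro mpol_eqI) (auto simp: vec_eq_iff mdeg_lt_coeff coeff_pCons split: nat.split)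
  \<comment> \<open>At x = 0 the identity for q F reads A = J A J with J the exchange
    matrix.\<close>
  have "poly ((mat q ** F 0) $ i $ j) 0 = poly ((Sm ** mconst A ** Tm) $ i $ j) 0" for i j
    by (simp add: A mat_def[of 1, symmetric])
  from this[of 1 1] this[of 1 2] have sym: "A $ 2 $ 2 = A $ 1 $ 1" "A $ 2 $ 1 = A $ 1 $ 2"
    by (simp_all add: FA mat_mult_nth) (simp_all add: Sm_def Tm_def q_def X_def matrix_matrix_mult_def sum_2)
  obtain \<Lambda> where \<Lambda>: "diffop 0 F (Qe 1) = mconst \<Lambda> ** Qe 1"
    using D by (auto simp: DW_iff)
  have "mcoeff (Qe 1 ** mconst A) k = mcoeff (Qe 1) k ** A" for k
    by (simp add: vec_eq_iff matrix_matrix_mult_def sum_2 mult.commute)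
  then have e: "mcoeff (Qe 1) k ** A = \<Lambda> ** mcoeff (Qe 1) k" for k
    using \<Lambda> by (simp add: diffop_def FA)
  define C where "C = mcoeff (Qe 1) 0"
  \<comment> \<open>The coefficient of x identifies the eigenvalue with A, and the constant term
    says that A commutes with C. As the off-diagonal entries of C differ for n \<noteq> 2 p, those
    of A vanish.\<close>
  have "\<Lambda> = A" using e[of 1] by (simp add: Qe_lead)
  with e[of 0] have "(C ** A) $ 1 $ 1 = (A ** C) $ 1 $ 1" by (simp add: C_def)
  then have "A $ 1 $ 2 * (C $ 1 $ 2 - C $ 2 $ 1) = 0"
    by (simp add: matrix_matrix_mult_def sum_2 sym algebra_simps)
  moreover have "complex_of_real (1 / (p + 1)) \<noteq> of_real (1 / (n - p + 1))"
    using p_pos p_less by (simp add: field_simps del: of_real_divide)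
  then have "C $ 1 $ 2 - C $ 2 $ 1 \<noteq> 0"
    by (simp only: C_def Qe_1_nth right_minus_eq not_False_eq_True)
  ultimately have "A $ 1 $ 2 = 0" by simp
  then have "F 0 = mat [:A $ 1 $ 1:]"
    using sym by (simp add: FA vec_eq_iff forall_2 mat_def)
  then show ?thesis ..
qed

lemma DW_subset_gen: "diffop s F \<in> DW \<Longrightarrow> diffop s F \<in> gen_algebra gens"
proof (induction s arbitrary: F rule: less_induct)
  case (less s)
  \<comment> \<open>Here s is only a formal order. A vanishing top coefficient lowers it, or leaves
    the zero operator when s = 0.\<close>
  have drop: "diffop s H \<in> gen_algebra gens" if H: "diffop s H \<in> DW" "H s = 0" for H
  proof (cases s)
    case 0
    have "diffop s H = (\<lambda>P. map_matrix (smult 0) P)"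
      using H(2) 0 by (simp add: fun_eq_iff diffop_def) (simp add: vec_eq_iff)
    then show ?thesis
      using gen_algebra.scale[OF gen_algebra.one] by metis
  next
    case (Suc t)
    have "diffop s H = diffop t H"
      using H(2) Suc by (simp add: fun_eq_iff diffop_def)
    then show ?thesis using less.IH[of t H] H(1) Suc by simp
  qed
  show ?case
  proof (cases "F s = 0")
    case True
    then show ?thesis using drop less.prems by blast
  next
    case False
    note top = top_coefficient[OF less.prems has_top_diffop False]
    then obtain k where k: "s = 2 * k" by (auto elim: evenE)
    obtain A where A: "mat q ** F s = mat (q ^ k) ** Sm ** mconst A ** Tm" using top k by auto
    show ?thesis
    proof (cases k)
      case 0
      then obtain a where "F 0 = mat [:a:]"
        using order_zero_scalar less.prems False k by auto
      then have "diffop s F = (\<lambda>P. map_matrix (smult a) P)"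
        using k 0 by (simp add: fun_eq_iff diffop_def map_matrix_smult(1))
      then show ?thesis
        using gen_algebra.scale[OF gen_algebra.one] by metis
    next
      case (Suc j)
      obtain E where E: "E \<in> gen_algebra gens" "has_top s E (mat (q ^ j) ** Sm ** mconst A ** Tm)"
        using gen_with_top[of j A] k Suc by auto
      have "mat q ** F s = mat q ** (mat (q ^ j) ** Sm ** mconst A ** Tm)"
        unfolding A by (simp add: Suc matrix_mul_assoc mat_mult_mat)
      then have E_top: "has_top s E (F s)"
        using E(2) by (simp add: mat_mult_cancel q_nz)
      \<comment> \<open>Subtracting E, which has the same leading coefficient, leaves an element of
        the algebra to which \<open>drop\<close> applies.\<close>
      define R where "R = (\<lambda>P. diffop s F P + map_matrix (smult (- 1)) (E P))"
      have "has_top s R (F s + F s ** mat [:- 1:])"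
        unfolding R_def by (intro has_top_add has_top_smult has_top_diffop E_top)
      moreover have "F s + F s ** mat [:- 1:] = 0"
        by (simp add: map_matrix_smult(1)[symmetric] vec_eq_iff)
      ultimately obtain H where H: "R = diffop s H" "H s = 0"
        using has_top_ex by metis
      have "R \<in> DW"
        unfolding R_def by (rule DW_add[OF less.prems DW_scale[OF gen_subset_DW[OF E(1)]]])
      then have "R \<in> gen_algebra gens"
        using drop H by simp
      then have "(\<lambda>P. R P + E P) \<in> gen_algebra gens"
        by (rule gen_algebra.add[OF _ E(1)])
      moreover have "(\<lambda>P. R P + E P) = diffop s F"
        by (simp add: R_def fun_eq_iff vec_eq_iff)
      ultimately show ?thesis by simp
    qed
  qed
qed

lemma DW_eq_gen: "DW = gen_algebra gens"
proof (intro equalityI subsetI)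
  fix D assume D: "D \<in> DW"
  then obtain s F where "D = diffop s F" by (auto simp: DW_iff)
  then show "D \<in> gen_algebra gens" using D DW_subset_gen by simp
qed (rule gen_subset_DW)

lemma DW_top_degree:
  assumes D: "diffop s F \<in> DW" and F: "F s \<noteq> 0"
  shows "even s \<and> mdegree (F s) = s"
proof -
  obtain A where s: "even s" and A: "mat q ** F s = mat (q ^ (s div 2)) ** Sm ** mconst A ** Tm"
    using top_coefficient[OF D has_top_diffop F] by auto
  then have deg: "mdeg_lt (F s) (Suc s)" "mcoeff (F s) s = A"
    using top_degree[OF A] by auto
  have "A \<noteq> 0"
  proof
    assume "A = 0"
    then have "mat q ** F s = mat q ** 0" by (simp add: A)
    then show False using F mat_mult_cancel[OF q_nz] by blast
  qed
  then show ?thesis using s deg mdegree_eqI by auto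
qed

end

theorem theorem4p3:
  fixes n p :: real
  assumes "0 < p" and "p < n / 2"
  shows "diff_algebra (weight n p) = gen_algebra {D1 n p, D2 n p, D3 n p, D4 n p} \<and>
    (\<forall>s F. diffop s F \<in> diff_algebra (weight n p) \<and> F s \<noteq> 0 \<longrightarrow>
       even s \<and> mdegree (F s) = s)"
proof -
  interpret gegenbauer_weight n p
    using assms by unfold_locales
  show ?thesis
    using DW_eq_gen DW_top_degree by blast
qed

end
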